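(* Let $n\geq2$. If $\mu$ is a Radon measure on $\mathbb{R}^n$ and $\Gamma$ is a rectifiable curve in $\mathbb{R}^n$, then $J^*_2(\mu,\cdot)\in L^1(\mu\llcorner\Gamma)$; in particular $J^*_2(\mu,x)<\infty$ for $\mu$-a.e. $x\in\Gamma$.
   Context: A rectifiable curve is the image $f([0,1])$ of a Lipschitz map $f:[0,1]\to\mathbb{R}^n$; $\mu\llcorner\Gamma(F)=\mu(\Gamma\cap F)$. Dyadic cubes are half open cubes $Q=\prod_{i=1}^n[j_i2^{-k},(j_i+1)2^{-k})$, $k,j_i\in\mathbb{Z}$, with side length $\ell(Q)=2^{-k}$ and $\mathrm{diam}\,Q=2^{-k}\sqrt n$; $\Delta_1(\mathbb{R}^n)$ denotes dyadic cubes of side length at most 1; $\lambda Q$ is the concentric dilate by $\lambda$. For a bounded Borel set $E$ of positive diameter and a line $\ell$, $\beta_2(\mu,E,\ell)^2=\int_E(\mathrm{dist}(x,\ell)/\mathrm{diam}\,E)^2\,d\mu(x)/\mu(E)$ ($=0$ if $\mu(E)=0$). $\Delta^*(Q)$ is the set of dyadic $R$ with $\ell(Q)\leq\ell(R)\leq2\ell(Q)$ and $3R\subseteq1600\sqrt n\,Q$; $\beta^*_2(\mu,Q)^2=\inf_\ell\max\{\beta_2(\mu,3R,\ell)^2\min(\mu(3R)/\mathrm{diam}\,3R,1):R\in\Delta^*(Q)\}$ over lines $\ell$; $J^*_2(\mu,x)=\sum_{Q\in\Delta_1(\mathbb{R}^n)}\beta^*_2(\mu,Q)^2\frac{\mathrm{diam}\,Q}{\mu(Q)}\chi_Q(x)$,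 with $0/0=0$, $1/0=\infty$. *)

theory Defs
  imports "HOL-Analysis.Analysis"
begin

text \<open>Radon measure on R^n: a measure on the Borel sets, finite on compact sets
  (on R^n every locally finite Borel measure is Borel regular, i.e. Radon).\<close>
definition radon_measure :: "(real^'n) measure \<Rightarrow> bool" where
  "radon_measure M \<longleftrightarrow> sets M = sets borel \<and> (\<forall>K. compact K \<longrightarrow> emeasure M K < \<infinity>)"

definition rectifiable_curve :: "(real^'n) set \<Rightarrow> bool" where
  "rectifiable_curve \<Gamma> \<longleftrightarrow>
     (\<exists>f C. C-lipschitz_on {0..1} (f :: real \<Rightarrow> real^'n) \<and> \<Gamma> = f ` {0..1})"

definition side :: "int \<Rightarrow> real" where
  "side k = 2 powr (- real_of_int k)"

definition dcube :: "int \<Rightarrow> ('n::finite \<Rightarrow> int) \<Rightarrow> (real^'n) set" where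
  "dcube k j = {x. \<forall>i. real_of_int (j i) * side k \<le> x $ i \<and> x $ i < (real_of_int (j i) + 1) * side k}"

definition dcenter :: "int \<Rightarrow> ('n::finite \<Rightarrow> int) \<Rightarrow> real^'n" where
  "dcenter k j = (\<chi> i. (real_of_int (j i) + 1/2) * side k)"

definition dcube_dil :: "real \<Rightarrow> int \<Rightarrow> ('n::finite \<Rightarrow> int) \<Rightarrow> (real^'n) set" where
  "dcube_dil lam k j = (\<lambda>x. dcenter k j + lam *\<^sub>R (x - dcenter k j)) ` dcube k j"

definition lines :: "(real^'n) set set" where
  "lines = {{a + t *\<^sub>R v | t. True} | a v. v \<noteq> 0}"

definition beta2sq :: "(real^'n) measure \<Rightarrow> (real^'n) set \<Rightarrow> (real^'n) set \<Rightarrow> real" where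
  "beta2sq M E l =
     (if measure M E = 0 then 0
      else (\<integral>x. indicator E x * (infdist x l / diameter E)^2 \<partial>M) / measure M E)"

definition Delta_star :: "int \<Rightarrow> ('n::finite \<Rightarrow> int) \<Rightarrow> (int \<times> ('n \<Rightarrow> int)) set" where
  "Delta_star k j = {(k', j'). side k \<le> side k' \<and> side k' \<le> 2 * side k \<and>
       dcube_dil 3 k' j' \<subseteq> dcube_dil (1600 * sqrt (real CARD('n))) k j}"

definition beta_star_sq :: "(real^'n::finite) measure \<Rightarrow> int \<Rightarrow> ('n \<Rightarrow> int) \<Rightarrow> real" where
  "beta_star_sq M k j =
     (INF l\<in>lines. SUP (k', j')\<in>Delta_star k j.
        beta2sq M (dcube_dil 3 k' j') l *
        min (measure M (dcube_dil 3 k' j') / diameter (dcube_dil 3 k' j')) 1)"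

text \<open>J^*_2(mu,x), summing over dyadic cubes of side length at most 1 (k >= 0),
  valued in [0,infinity]; ennreal division gives 0/0 = 0 and c/0 = infinity for c > 0.\<close>
definition J_star2 :: "(real^'n::finite) measure \<Rightarrow> real^'n \<Rightarrow> ennreal" where
  "J_star2 M x =
     (\<Sum>\<^sub>\<infinity>(k, j)\<in>{(k::int, j::'n \<Rightarrow> int). 0 \<le> k}.
        ennreal (beta_star_sq M k j) * ennreal (diameter (dcube k j)) / emeasure M (dcube k j)
        * indicator (dcube k j) x)"

end

theory Submission
  imports Defs
begin

text \<open>Let \<open>Q\<close> be a dyadic cube of side \<open>r\<close> meeting \<open>\<Gamma>\<close> and let \<open>\<eta>\<close> be the largest distance to a suitable line \<open>l\<close>
  of the points of \<open>\<Gamma>\<close> near \<open>Q\<close>. Since \<open>dist(x,l) \<le> dist(x,\<Gamma>) + \<eta>\<close>, the contribution of \<open>Q\<close> to the integral of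
  \<open>J\<^sup>*\<^sub>2\<close> over \<open>\<Gamma>\<close> is at most a constant times \<open>\<eta>\<^sup>2/r + r\<^sup>-\<^sup>2 \<integral> dist(x,\<Gamma>)\<^sup>2 d\<mu>\<close>, with the integral over \<open>1600\<surd>n Q\<close>.
  For a fixed \<open>x\<close> the second terms form a geometric series. The first terms are summed by
  integral geometry, in the spirit of Crofton's formula: when \<open>\<eta> > 0\<close>, a set of hyperplanes \<open>x\<^sub>i - m x\<^sub>j = q\<close>
  of measure comparable to \<open>\<eta>\<^sup>2/r\<close> in the \<open>(m,q)\<close>-plane meets \<open>\<Gamma>\<close> near \<open>Q\<close> in two points at distance comparable
  to \<open>r\<close>. A hyperplane meeting \<open>\<Gamma>\<close> in \<open>N\<close> points does this for at most \<open>C N\<close> cubes, and the integral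
  of \<open>N\<close> is at most a constant times the Lipschitz constant of the parametrization.\<close>

section \<open>Counting cubes with two separated points\<close>

text \<open>No density or doubling property of the measure is available, and this shapes the
  estimate. Integrating over \<open>\<Gamma> \<inter> Q\<close> cancels the mass of
  \<open>Q\<close>. In \<open>beta_star_sq\<close>, the minimum of \<open>\<mu>(3R)/diam\<close> and
  1 is used in both ways: its first argument cancels the normalization in front of the distance to
  \<open>\<Gamma>\<close>, and its second keeps the term in \<open>\<eta>\<close> free of the
  measure. The size \<open>\<eta>\<^sup>2/r\<close> is an area: tilting a hyperplane by a small
  multiple of \<open>\<eta>/r\<close> or shifting it by one of \<open>\<eta>\<close> changes
  \<open>x$i - m * x$j - q\<close> by a small multiple of \<open>\<eta>\<close> on a ball of radius
  comparable to \<open>r\<close>, so a parallelogram of these dimensions consists of good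
  hyperplanes. Two distant hits are demanded because one hit cannot be counted: a single point lies
  in a cube of every generation, whereas two points at distance comparable to \<open>r\<close> tie
  the cube to that scale. The obstacle is to get two distant arcs crossed by one hyperplane from the
  mere fact that some point is off a line. That point may be close to where the line was drawn,
  which is why a second reference arc is kept.\<close>

definition packing :: "real \<Rightarrow> 'a::metric_space set \<Rightarrow> nat" where
  "packing \<theta> S = Max (card ` {T. T \<subseteq> S \<and> pairwise (\<lambda>x y. \<theta> \<le> dist x y) T})"

lemma packing_attained:
  assumes "finite S"
  obtains T where "T \<subseteq> S" "pairwise (\<lambda>x y. \<theta> \<le> dist x y) T" "card T = packing \<theta> S"
proof -
  let ?F = "{T. T \<subseteq> S \<and> pairwise (\<lambda>x y. \<theta> \<le> dist x y) T}"
  have "finite ?F" using assms by simp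
  moreover have "{} \<in> ?F" by simp
  ultimately have "Max (card ` ?F) \<in> card ` ?F" by (intro Max_in) auto
  then show ?thesis using that unfolding packing_def by auto
qed

lemma card_le_packing:
  assumes "finite S" "T \<subseteq> S" "pairwise (\<lambda>x y. \<theta> \<le> dist x y) T"
  shows "card T \<le> packing \<theta> S"
  unfolding packing_def using assms by (intro Max_ge) auto

lemma packing_le_card: "finite S \<Longrightarrow> packing \<theta> S \<le> card S"
  by (metis packing_attained card_mono)

text \<open>A largest \<open>B\<close>-separated set \<open>T\<close> absorbs one new point for each
  \<open>i\<close>. If both points of a pair were \<open>\<theta>\<close>-close to \<open>T\<close>,
  a common neighbour would put them less than \<open>2 * \<theta>\<close> apart, and two different
  neighbours would be closer than \<open>2 * \<rho> + 2 * \<theta> \<le> B\<close>. The separation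
  of the centres keeps the new points apart from each other.\<close>

lemma packing_gain:
  fixes S :: "'a::metric_space set"
  assumes S: "finite S" and J: "finite J" and "0 < \<theta>" "0 \<le> \<rho>" and B: "2 * \<rho> + 2 * \<theta> \<le> B"
    and pairs: "\<And>i. i \<in> J \<Longrightarrow> \<exists>s\<in>S. \<exists>s'\<in>S. dist (p i) s \<le> \<rho> \<and> dist (p i) s' \<le> \<rho> \<and> 2 * \<theta> \<le> dist s s'"
    and sep: "\<And>i i'. i \<in> J \<Longrightarrow> i' \<in> J \<Longrightarrow> i \<noteq> i' \<Longrightarrow> 2 * \<rho> + \<theta> \<le> dist (p i) (p i')"
  shows "packing B S + card J \<le> packing \<theta> S"
proof -
  obtain T where T: "T \<subseteq> S" "pairwise (\<lambda>x y. B \<le> dist x y) T" "card T = packing B S"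
    using packing_attained[OF S] .
  have "\<exists>z\<in>S. dist (p i) z \<le> \<rho> \<and> (\<forall>t\<in>T. \<theta> \<le> dist z t)" if i: "i \<in> J" for i
  proof (rule ccontr)
    assume contra: "\<not> ?thesis"
    obtain s s' where s: "s \<in> S" "s' \<in> S" "dist (p i) s \<le> \<rho>" "dist (p i) s' \<le> \<rho>" "2 * \<theta> \<le> dist s s'"
      using pairs[OF i] by blast
    obtain t t' where t: "t \<in> T" "t' \<in> T" "dist s t < \<theta>" "dist s' t' < \<theta>"
      using contra s by (meson not_le)
    show False
    proof (cases "t = t'")
      case True
      then have "dist s' t < \<theta>" using t by simp
      then show False using t s(5) dist_triangle2[of s s' t] by linarith
    next
      case False
      then have "B \<le> dist t t'" using T(2) t by (auto simp: pairwise_def)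
      moreover have "dist t t' \<le> dist s t + dist s s' + dist s' t'"
        using dist_triangle[of t t' s] dist_triangle[of s t' s'] by (simp add: dist_commute)
      moreover have "dist s s' \<le> dist (p i) s + dist (p i) s'"
        by (rule dist_triangle3)
      ultimately show False using t s B by linarith
    qed
  qed
  then obtain z where z: "\<And>i. i \<in> J \<Longrightarrow> z i \<in> S" "\<And>i. i \<in> J \<Longrightarrow> dist (p i) (z i) \<le> \<rho>"
    "\<And>i t. i \<in> J \<Longrightarrow> t \<in> T \<Longrightarrow> \<theta> \<le> dist (z i) t" by metis
  have zz: "\<theta> \<le> dist (z i) (z i')" if "i \<in> J" "i' \<in> J" "i \<noteq> i'" for i i'
  proof -
    have "dist (p i) (p i') \<le> dist (p i) (z i) + dist (z i) (z i') + dist (p i') (z i')"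
      using dist_triangle[of "p i" "p i'" "z i"] dist_triangle[of "z i" "p i'" "z i'"]
      by (simp add: dist_commute)
    then show ?thesis using z(2)[OF that(1)] z(2)[OF that(2)] sep[OF that] by linarith
  qed
  have inj: "inj_on z J"
    using zz \<open>0 < \<theta>\<close> by (force simp: inj_on_def)
  have disj: "T \<inter> z ` J = {}"
    using z(3) \<open>0 < \<theta>\<close> by (force simp: disjoint_iff)
  have "pairwise (\<lambda>x y. \<theta> \<le> dist x y) T"
    using T(2) B \<open>0 < \<theta>\<close> \<open>0 \<le> \<rho>\<close> by (fastforce simp: pairwise_def)
  then have "pairwise (\<lambda>x y. \<theta> \<le> dist x y) (T \<union> z ` J)"
    using zz z(3) unfolding pairwise_def by (auto simp: dist_commute)
  then have "card (T \<union> z ` J) \<le> packing \<theta> S"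
    using card_le_packing[OF S, of "T \<union> z ` J"] T(1) z(1) by blast
  moreover have "card (T \<union> z ` J) = card T + card J"
    using card_Un_disjoint[OF finite_subset[OF T(1) S] finite_imageI[OF J] disj] card_image[OF inj]
    by simp
  ultimately show ?thesis using T(3) by simp
qed

text \<open>Only the last \<open>K\<close> terms of the shifted sum lie outside
  \<open>{..<N}\<close>. For packing numbers this telescopes the gains over \<open>K\<close>
  generations into a bound linear in \<open>card S\<close>.\<close>

lemma sum_shift_le:
  fixes P :: "nat \<Rightarrow> nat"
  assumes "\<And>k. P k \<le> b"
  shows "(\<Sum>k<N. P (k + K)) \<le> (\<Sum>k<N. P k) + K * b"
proof -
  have "(\<Sum>k<N. P (k + K)) = sum P {K..<N + K}"
    using sum.shift_bounds_nat_ivl[of P 0 K N] by (simp add: lessThan_atLeast0)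
  also have "\<dots> \<le> sum P ({..<N} \<union> {N..<N + K})"
    by (intro sum_mono2) auto
  also have "\<dots> \<le> sum P {..<N} + sum P {N..<N + K}"
    by (subst sum.union_disjoint) auto
  also have "sum P {N..<N + K} \<le> K * b"
    using sum_bounded_above[of "{N..<N + K}" P b] assms by simp
  finally show ?thesis by simp
qed

section \<open>Dyadic cubes of one generation\<close>

lemma side_pos [simp]: "0 < side k"
  by (simp add: side_def)

lemma side_nonneg [simp]: "0 \<le> side k"
  by (simp add: side_def)

lemma side_nat: "side (int k) = (1 / 2) ^ k"
  by (simp add: side_def powr_minus powr_realpow power_one_over inverse_eq_divide)

lemma dist_dcenter_ge:
  fixes j j' :: "'n::finite \<Rightarrow> int"
  assumes "j \<noteq> j'" and "\<And>i. j i mod int m = j' i mod int m"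
  shows "real m * side k \<le> dist (dcenter k j) (dcenter k j')"
proof -
  obtain i where i: "j i \<noteq> j' i" using assms(1) by blast
  have "int m dvd j i - j' i" using assms(2)[of i] by (simp add: mod_eq_dvd_iff)
  then have "int m \<le> \<bar>j i - j' i\<bar>"
    using i by (metis abs_of_nat dvd_imp_le_int right_minus_eq)
  then have "real m \<le> \<bar>real_of_int (j i) - real_of_int (j' i)\<bar>" by linarith
  then have "real m * side k \<le> \<bar>real_of_int (j i) - real_of_int (j' i)\<bar> * side k"
    by (intro mult_right_mono) (auto simp: less_imp_le)
  also have "\<dots> = \<bar>(dcenter k j - dcenter k j') $ i\<bar>"
    by (simp add: dcenter_def abs_mult abs_of_pos flip: left_diff_distrib)
  also have "\<dots> \<le> dist (dcenter k j) (dcenter k j')"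
    unfolding dist_norm by (rule component_le_norm_cart)
  finally show ?thesis .
qed

text \<open>Splitting the cubes of one generation by the residues of their indices makes the cubes of each
  class far apart, so every cube of a class contributes a new point when the packing is refined.
  Each point of \<open>S\<close> is new in boundedly many generations.\<close>
lemma count_cubes:
  fixes \<rho> :: real
  assumes "0 \<le> \<rho>"
  obtains C :: nat where "\<And>(S :: (real^'n) set) F. finite S \<Longrightarrow> finite F \<Longrightarrow>
     (\<And>k j. (k, j) \<in> F \<Longrightarrow> 0 \<le> k \<and> (\<exists>s\<in>S. \<exists>s'\<in>S. dist (dcenter k j) s \<le> \<rho> * side k \<and>
         dist (dcenter k j) s' \<le> \<rho> * side k \<and> side k / 4 \<le> dist s s')) \<Longrightarrow>
     card F \<le> C * card S"
proof -
  obtain m0 :: nat where m0: "2 * \<rho> + 1 / 8 \<le> real m0" using real_arch_simple by blast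
  define m where "m = max m0 1"
  have m: "2 * \<rho> + 1 / 8 \<le> real m" "1 \<le> m" using m0 by (auto simp: m_def)
  \<comment> \<open>Multiplied by \<open>side k / 8\<close>, this is the requirement on
    \<open>B\<close> in \<open>packing_gain\<close> with \<open>\<theta> = side k / 8\<close> and
    radius \<open>\<rho> * side k\<close>.\<close>
  obtain K :: nat where K: "16 * \<rho> + 2 < 2 ^ K"
    using real_arch_pow[of 2 "16 * \<rho> + 2"] by auto
  let ?col = "{c :: 'n \<Rightarrow> int. \<forall>i. c i \<in> {0..<int m}}"
  have fin_col: "finite ?col"
    using finite_set_of_finite_funs[of "UNIV :: 'n set" "{0..<int m}" undefined] by simp
  have "card F \<le> (card ?col * K) * card S"
    if S: "finite S" and F: "finite F" and
      H: "\<And>k j. (k, j) \<in> F \<Longrightarrow> 0 \<le> k \<and> (\<exists>s\<in>S. \<exists>s'\<in>S. dist (dcenter k j) s \<le> \<rho> * side k \<and>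
         dist (dcenter k j) s' \<le> \<rho> * side k \<and> side k / 4 \<le> dist s s')"
    for S :: "(real^'n) set" and F
  proof -
    \<comment> \<open>The scale is chosen so that \<open>P (k + K)\<close> is the packing number at
      \<open>side k / 8\<close>, while \<open>P k\<close> is the one at the coarser scale
      \<open>B\<close>.\<close>
    define P where "P k = packing (2 ^ K * (1 / 2) ^ k / 8) S" for k
    define G where "G k c = {j. (int k, j) \<in> F \<and> (\<forall>i. j i mod int m = c i)}" for k and c :: "'n \<Rightarrow> int"
    have finG: "finite (G k c)" for k c
      by (rule finite_subset[OF _ finite_imageI[OF F, of snd]]) (force simp: G_def image_iff)
    have gain: "P k + card (G k c) \<le> P (k + K)" for k c
    proof -
      have "packing (2 ^ K * side (int k) / 8) S + card (G k c) \<le> packing (side (int k) / 8) S"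
      proof (rule packing_gain[OF S finG, where p = "dcenter (int k)" and \<rho> = "\<rho> * side (int k)"])
        show "0 \<le> \<rho> * side (int k)" using assms by (simp add: less_imp_le)
        show "2 * (\<rho> * side (int k)) + 2 * (side (int k) / 8) \<le> 2 ^ K * side (int k) / 8"
          using mult_right_mono[OF less_imp_le[OF K], of "side (int k) / 8"]
          by (simp add: algebra_simps less_imp_le)
        fix i i' assume ii: "i \<in> G k c" "i' \<in> G k c" "i \<noteq> i'"
        then have "real m * side (int k) \<le> dist (dcenter (int k) i) (dcenter (int k) i')"
          by (intro dist_dcenter_ge) (auto simp: G_def)
        moreover have "(2 * \<rho> + 1 / 8) * side (int k) \<le> real m * side (int k)"
          using m(1) by (intro mult_right_mono) (auto simp: less_imp_le)
        ultimately show "2 * (\<rho> * side (int k)) + side (int k) / 8 \<le> dist (dcenter (int k) i) (dcenter (int k) i')"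
          by (simp add: algebra_simps)
      qed (use H in \<open>auto simp: G_def\<close>)
      then show ?thesis by (simp add: P_def side_nat power_add power_divide)
    qed
    obtain N where N: "\<And>k j. (k, j) \<in> F \<Longrightarrow> nat k < N"
    proof -
      have "finite ((\<lambda>x. nat (fst x)) ` F)" using F by simp
      then obtain N where "\<forall>x\<in>(\<lambda>x. nat (fst x)) ` F. x < N" using finite_nat_set_iff_bounded by blast
      then show ?thesis using that by force
    qed
    have "F \<subseteq> (\<Union>c\<in>?col. \<Union>k<N. (\<lambda>j. (int k, j)) ` G k c)"
    proof
      fix x assume x: "x \<in> F"
      obtain k j where kj: "x = (k, j)" by force
      have "k = int (nat k)" "nat k < N" using x H N unfolding kj by auto
      moreover have "j \<in> G (nat k) (\<lambda>i. j i mod int m)" using x \<open>k = int (nat k)\<close> by (simp add: G_def kj)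
      moreover have "(\<lambda>i. j i mod int m) \<in> ?col" using m(2) by simp
      ultimately show "x \<in> (\<Union>c\<in>?col. \<Union>k<N. (\<lambda>j. (int k, j)) ` G k c)"
        unfolding kj by blast
    qed
    then have "card F \<le> card (\<Union>c\<in>?col. \<Union>k<N. (\<lambda>j. (int k, j)) ` G k c)"
      by (intro card_mono finite_UN_I[OF fin_col] finite_UN_I[OF finite_lessThan] finite_imageI finG)
    also have "\<dots> \<le> (\<Sum>c\<in>?col. card (\<Union>k<N. (\<lambda>j. (int k, j)) ` G k c))"
      by (rule card_UN_le[OF fin_col])
    also have "\<dots> \<le> (\<Sum>c\<in>?col. K * card S)"
    proof (rule sum_mono)
      fix c assume "c \<in> ?col"
      have "card (\<Union>k<N. (\<lambda>j. (int k, j)) ` G k c) \<le> (\<Sum>k<N. card ((\<lambda>j. (int k, j)) ` G k c))"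
        by (rule card_UN_le) simp
      also have "\<dots> = (\<Sum>k<N. card (G k c))"
        by (intro sum.cong refl card_image) (auto simp: inj_on_def)
      finally have "(\<Sum>k<N. P k) + card (\<Union>k<N. (\<lambda>j. (int k, j)) ` G k c) \<le> (\<Sum>k<N. P k + card (G k c))"
        by (simp add: sum.distrib)
      also have "\<dots> \<le> (\<Sum>k<N. P (k + K))"
        by (intro sum_mono gain)
      also have "\<dots> \<le> (\<Sum>k<N. P k) + K * card S"
        by (rule sum_shift_le) (simp add: P_def packing_le_card[OF S])
      finally show "card (\<Union>k<N. (\<lambda>j. (int k, j)) ` G k c) \<le> K * card S" by simp
    qed
    finally show ?thesis by (simp add: mult.assoc)
  qed
  then show ?thesis using that by blast
qed

section \<open>Hyperplanes meeting a Lipschitz curve\<close>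

text \<open>Hyperplanes with slope within \<open>\<alpha>\<close> of \<open>m0\<close> that pass
  within \<open>w\<close>, measured along the \<open>i\<close>-axis, of a point with
  \<open>x$j = z\<close> and \<open>x$i = q0\<close>. Measuring the offset over \<open>z\<close>
  instead of the origin is a shear, so it does not affect the area.\<close>

definition strip :: "real \<Rightarrow> real \<Rightarrow> real \<Rightarrow> real \<Rightarrow> real \<Rightarrow> (real \<times> real) set" where
  "strip m0 \<alpha> z q0 w = {(m, q). \<bar>m - m0\<bar> \<le> \<alpha> \<and> \<bar>q + m * z - q0\<bar> \<le> w}"

lemma strip_measurable [measurable]: "strip m0 \<alpha> z q0 w \<in> sets borel"
proof -
  have "strip m0 \<alpha> z q0 w = {x. \<bar>fst x - m0\<bar> \<le> \<alpha>} \<inter> {x. \<bar>snd x + fst x * z - q0\<bar> \<le> w}"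
    by (auto simp: strip_def)
  moreover have "closed \<dots>"
    by (intro closed_Int closed_Collect_le continuous_intros)
  ultimately show ?thesis by (simp add: borel_closed)
qed

lemma emeasure_strip:
  assumes "0 \<le> \<alpha>" "0 \<le> w"
  shows "emeasure lborel (strip m0 \<alpha> z q0 w) = ennreal (4 * \<alpha> * w)"
proof -
  have "emeasure lborel (strip m0 \<alpha> z q0 w)
      = (\<integral>\<^sup>+ m. emeasure lborel (Pair m -` strip m0 \<alpha> z q0 w) \<partial>lborel)"
    unfolding lborel_prod[symmetric]
    by (rule lborel.emeasure_pair_measure_alt) (simp only: lborel_prod sets_lborel strip_measurable)
  also have "\<dots> = (\<integral>\<^sup>+ m. ennreal (2 * w) * indicator {m0 - \<alpha>..m0 + \<alpha>} m \<partial>lborel)"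
  proof (rule nn_integral_cong)
    fix m
    have "Pair m -` strip m0 \<alpha> z q0 w = (if m \<in> {m0 - \<alpha>..m0 + \<alpha>} then {q0 - m * z - w..q0 - m * z + w} else {})"
      by (auto simp: strip_def abs_le_iff)
    then show "emeasure lborel (Pair m -` strip m0 \<alpha> z q0 w) = ennreal (2 * w) * indicator {m0 - \<alpha>..m0 + \<alpha>} m"
      using assms by simp
  qed
  also have "\<dots> = ennreal (2 * w) * ennreal (2 * \<alpha>)"
    using assms by (simp add: nn_integral_cmult_indicator)
  also have "\<dots> = ennreal (4 * \<alpha> * w)"
    using assms by (simp add: ennreal_mult[symmetric] mult_ac)
  finally show ?thesis .
qed

text \<open>A discretization of the number of parameters \<open>t\<close> with \<open>f(t)\<^sub>i - m f(t)\<^sub>j = q\<close>, for \<open>\<bar>m\<bar> \<le> 2\<close>; it is measurable in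
  \<open>(m, q)\<close> by construction.\<close>
definition incidence :: "(real \<Rightarrow> real^'n) \<Rightarrow> real \<Rightarrow> 'n \<Rightarrow> 'n \<Rightarrow> nat \<Rightarrow> real \<times> real \<Rightarrow> ennreal" where
  "incidence f L i j k x =
     (\<Sum>l\<le>2 ^ k. indicator (strip 0 2 (f (real l / 2 ^ k) $ j) (f (real l / 2 ^ k) $ i) (3 * L / 2 ^ k)) x)"

lemma incidence_measurable [measurable]:
  "incidence f L i j k \<in> borel_measurable borel"
  unfolding incidence_def by measurable

text \<open>Fatou's lemma, then at most \<open>2 * 2 ^ k\<close> strips of area
  \<open>24 * L / 2 ^ k\<close> each: the upper half of Crofton's formula up to a constant.\<close>

lemma nn_integral_liminf_incidence:
  assumes "0 \<le> L"
  shows "(\<integral>\<^sup>+ x. liminf (\<lambda>k. incidence f L i j k x) \<partial>lborel) \<le> ennreal (48 * L)"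
proof -
  have "(\<integral>\<^sup>+ x. liminf (\<lambda>k. incidence f L i j k x) \<partial>lborel)
      \<le> liminf (\<lambda>k. \<integral>\<^sup>+ x. incidence f L i j k x \<partial>lborel)"
    by (rule nn_integral_liminf) simp
  also have "\<dots> \<le> liminf (\<lambda>k::nat. ennreal (48 * L))"
  proof (rule Liminf_mono, rule always_eventually, rule allI)
    fix k :: nat
    have "(\<integral>\<^sup>+ x. incidence f L i j k x \<partial>lborel)
        = (\<Sum>l\<le>2 ^ k. emeasure lborel
            (strip 0 2 (f (real l / 2 ^ k) $ j) (f (real l / 2 ^ k) $ i) (3 * L / 2 ^ k)))"
      unfolding incidence_def by (subst nn_integral_sum) auto
    also have "\<dots> = (\<Sum>l\<le>(2::nat) ^ k. ennreal (4 * 2 * (3 * L / 2 ^ k)))"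
      using assms by (intro sum.cong refl emeasure_strip) auto
    also have "\<dots> = ennreal (\<Sum>l\<le>(2::nat) ^ k. 4 * 2 * (3 * L / 2 ^ k))"
      using assms by (intro sum_ennreal) auto
    also have "\<dots> = ennreal ((2 ^ k + 1) * (4 * 2 * (3 * L / 2 ^ k)))"
      by (simp add: add.commute)
    also have "\<dots> \<le> ennreal (48 * L)"
    proof (rule ennreal_leI)
      have "(2 ^ k + 1) * (4 * 2 * (3 * L / 2 ^ k)) \<le> (2 ^ k + 2 ^ k) * (4 * 2 * (3 * L / 2 ^ k))"
        using assms by (intro mult_right_mono add_left_mono) auto
      also have "\<dots> = 48 * L" by (simp add: field_simps)
      finally show "(2 ^ k + 1) * (4 * 2 * (3 * L / 2 ^ k)) \<le> 48 * L" .
    qed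
    finally show "(\<integral>\<^sup>+ x. incidence f L i j k x \<partial>lborel) \<le> ennreal (48 * L)" .
  qed
  finally show ?thesis by (simp add: Liminf_const)
qed

lemma eventually_floor_dyadic_neq:
  fixes s t :: real
  assumes "s \<noteq> t" "0 \<le> s" "0 \<le> t"
  shows "eventually (\<lambda>k. nat \<lfloor>s * 2 ^ k\<rfloor> \<noteq> nat \<lfloor>t * 2 ^ k\<rfloor>) sequentially"
proof -
  obtain n where n: "(1 / 2) ^ n < \<bar>s - t\<bar>"
    using real_arch_pow_inv[of "\<bar>s - t\<bar>" "1 / 2"] assms by auto
  show ?thesis
    unfolding eventually_sequentially
  proof (intro exI allI impI)
    fix k assume "n \<le> k"
    then have "(1 / 2 :: real) ^ k \<le> (1 / 2) ^ n" by (intro power_decreasing) auto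
    then have "(1 / 2) ^ k < \<bar>s - t\<bar>" using n by linarith
    then have "(1 / 2) ^ k * 2 ^ k < \<bar>s - t\<bar> * 2 ^ k" by (intro mult_strict_right_mono) auto
    then have "1 < \<bar>s * 2 ^ k - t * 2 ^ k\<bar>"
      by (simp add: power_one_over abs_mult flip: left_diff_distrib)
    moreover have "0 \<le> s * 2 ^ k" "0 \<le> t * 2 ^ k" using assms by auto
    ultimately show "nat \<lfloor>s * 2 ^ k\<rfloor> \<noteq> nat \<lfloor>t * 2 ^ k\<rfloor>" by linarith
  qed
qed

text \<open>Rounding a parameter down to the grid of mesh \<open>1 / 2 ^ k\<close> moves
  \<open>f\<close> by at most \<open>L / 2 ^ k\<close>, hence \<open>x$i - m * x$j\<close> by at
  most three times that; this is the half-width used in \<open>incidence\<close>. On a fine enough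
  grid distinct parameters occupy distinct nodes, so each point has a strip of its own.\<close>

lemma card_le_liminf_incidence:
  fixes f :: "real \<Rightarrow> real^'n"
  assumes f: "L-lipschitz_on {0..1} f" and m: "\<bar>m\<bar> \<le> 2" and S: "finite S" "S \<subseteq> f ` {0..1}"
    and hit: "\<And>s. s \<in> S \<Longrightarrow> s $ i - m * s $ j = q"
  shows "of_nat (card S) \<le> liminf (\<lambda>k. incidence f L i j k (m, q))"
proof -
  obtain T where T: "T \<subseteq> {0..1}" "finite T" "S = f ` T"
    using finite_subset_image[OF S] by blast
  let ?fl = "\<lambda>k t. nat \<lfloor>t * 2 ^ k :: real\<rfloor>"
  have "eventually (\<lambda>k. \<forall>s\<in>T. \<forall>t\<in>T. s \<noteq> t \<longrightarrow> ?fl k s \<noteq> ?fl k t) sequentially"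
  proof (intro eventually_ball_finite T(2) ballI)
    fix s t assume "s \<in> T" "t \<in> T"
    then show "eventually (\<lambda>k. s \<noteq> t \<longrightarrow> ?fl k s \<noteq> ?fl k t) sequentially"
      using eventually_floor_dyadic_neq[of s t] T(1) by (cases "s = t") (auto simp: subset_iff)
  qed
  then have "eventually (\<lambda>k. of_nat (card S) \<le> incidence f L i j k (m, q)) sequentially"
  proof (rule eventually_mono)
    fix k assume "\<forall>s\<in>T. \<forall>t\<in>T. s \<noteq> t \<longrightarrow> ?fl k s \<noteq> ?fl k t"
    then have inj: "inj_on (?fl k) T" by (auto simp: inj_on_def)
    have mem: "?fl k t \<le> 2 ^ k \<and>
       (m, q) \<in> strip 0 2 (f (real (?fl k t) / 2 ^ k) $ j) (f (real (?fl k t) / 2 ^ k) $ i) (3 * L / 2 ^ k)"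
      if t: "t \<in> T" for t
    proof -
      have t01: "0 \<le> t" "t \<le> 1" using t T(1) by auto
      let ?t = "real (?fl k t) / 2 ^ k"
      have r: "real (?fl k t) = of_int \<lfloor>t * 2 ^ k\<rfloor>" using t01 by simp
      have "real (?fl k t) \<le> t * 2 ^ k" "t * 2 ^ k \<le> real (?fl k t) + 1"
        unfolding r by linarith+
      then have tt: "?t \<le> t" "t \<le> ?t + 1 / 2 ^ k" by (auto simp: field_simps)
      have "t * 2 ^ k \<le> 2 ^ k" using t01 by simp
      then have "real (?fl k t) \<le> 2 ^ k"
        using \<open>real (?fl k t) \<le> t * 2 ^ k\<close> by linarith
      then have le: "?fl k t \<le> 2 ^ k" by (metis of_nat_le_iff of_nat_numeral of_nat_power)
      have "dist (f t) (f ?t) \<le> L * dist t ?t"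
      proof (rule lipschitz_onD[OF f])
        have "0 \<le> ?t" "?t \<le> 1" using order_trans[OF tt(1) t01(2)] by simp_all
        then show "?t \<in> {0..1}" by (simp only: atLeastAtMost_iff)
      qed (use t01 in auto)
      also have "\<dots> \<le> L * (1 / 2 ^ k)"
        using tt lipschitz_on_nonneg[OF f] by (intro mult_left_mono) (auto simp: dist_real_def)
      finally have d: "norm (f t - f ?t) \<le> L / 2 ^ k" by (simp add: dist_norm)
      have i: "\<bar>f t $ i - f ?t $ i\<bar> \<le> L / 2 ^ k" and j: "\<bar>f t $ j - f ?t $ j\<bar> \<le> L / 2 ^ k"
        using d component_le_norm_cart[of "f t - f ?t" i] component_le_norm_cart[of "f t - f ?t" j] by auto
      have mj: "\<bar>m * (f t $ j - f ?t $ j)\<bar> \<le> 2 * (L / 2 ^ k)"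
        unfolding abs_mult using m j by (intro mult_mono) auto
      have "q = f t $ i - m * f t $ j" using hit t T(3) by auto
      then have "\<bar>q + m * f ?t $ j - f ?t $ i\<bar> \<le> 3 * L / 2 ^ k"
      proof -
        have "q + m * f ?t $ j - f ?t $ i = (f t $ i - f ?t $ i) - m * (f t $ j - f ?t $ j)"
          using \<open>q = f t $ i - m * f t $ j\<close> by (simp add: algebra_simps)
        moreover have "3 * L / 2 ^ k = L / 2 ^ k + 2 * (L / 2 ^ k)" by simp
        ultimately show ?thesis
          using i mj by linarith
      qed
      then show ?thesis using le m by (simp add: strip_def)
    qed
    have "of_nat (card S) \<le> (of_nat (card T) :: ennreal)"
      using T card_image_le by (auto intro: of_nat_mono)
    also have "\<dots> = of_nat (card (?fl k ` T))" by (simp add: card_image[OF inj])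
    also have "\<dots> = (\<Sum>l\<in>?fl k ` T. 1)" by simp
    also have "\<dots> = (\<Sum>l\<in>?fl k ` T.
        indicator (strip 0 2 (f (real l / 2 ^ k) $ j) (f (real l / 2 ^ k) $ i) (3 * L / 2 ^ k)) (m, q))"
      using mem by (intro sum.cong refl) (auto simp: indicator_def)
    also have "\<dots> \<le> incidence f L i j k (m, q)"
      unfolding incidence_def using mem by (intro sum_mono2) auto
    finally show "of_nat (card S) \<le> incidence f L i j k (m, q)" .
  qed
  then show ?thesis by (rule Liminf_bounded)
qed

section \<open>Hyperplanes separating two pairs of points\<close>

text \<open>The planar determinant. For \<open>e \<noteq> 0\<close>, \<open>cross2 e (x - p)\<close>
  vanishes exactly on the line through \<open>p\<close> with direction \<open>e\<close>, and its
  sign tells the side.\<close>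

definition cross2 :: "real \<times> real \<Rightarrow> real \<times> real \<Rightarrow> real" where
  "cross2 v w = fst v * snd w - snd v * fst w"

text \<open>The sup norm rather than the Euclidean one: a direction with \<open>maxc e = 1\<close>
  has a component of modulus 1, so its line is a graph of slope at most 1 over one of the two
  axes.\<close>

definition maxc :: "real \<times> real \<Rightarrow> real" where
  "maxc v = max \<bar>fst v\<bar> \<bar>snd v\<bar>"

lemma cross2_linear:
  "cross2 (u + v) w = cross2 u w + cross2 v w" "cross2 (u - v) w = cross2 u w - cross2 v w"
  "cross2 w (u + v) = cross2 w u + cross2 w v" "cross2 w (u - v) = cross2 w u - cross2 w v"
  "cross2 (t *\<^sub>R u) w = t * cross2 u w" "cross2 w (t *\<^sub>R u) = t * cross2 w u"
  "cross2 w w = 0" "cross2 0 w = 0" "cross2 w 0 = 0" "cross2 (- u) w = - cross2 u w" "cross2 w (- u) = - cross2 w u"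
  by (simp_all add: cross2_def algebra_simps)

text \<open>The line through \<open>a + 2/3(b - a)\<close> and \<open>c + 2/3(d - c)\<close> works once \<open>d\<close> is the endpoint of
  \<open>cd\<close> farther from the line \<open>ab\<close> and \<open>b\<close> the endpoint of \<open>ab\<close> farther from the line \<open>cd\<close>.\<close>
lemma separating_line_aux:
  fixes a b c d :: "real \<times> real"
  assumes R: "maxc (b - a) \<le> R" "maxc (c - a) \<le> R" "maxc (d - a) \<le> R" "maxc (c - b) \<le> R" "maxc (d - b) \<le> R"
      "maxc (d - c) \<le> R"
    and \<rho>: "0 < \<rho>" "\<rho> \<le> maxc (d - c)"
    and D: "0 < D" "D \<le> \<bar>cross2 (b - a) (d - a)\<bar>"
    and ord: "\<bar>cross2 (b - a) (c - a)\<bar> \<le> \<bar>cross2 (b - a) (d - a)\<bar>"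
      "\<bar>cross2 (d - c) (a - c)\<bar> \<le> \<bar>cross2 (d - c) (b - c)\<bar>"
  obtains e p where "maxc e = 1"
    "D * \<rho> / (54 * R\<^sup>2) \<le> \<bar>cross2 e (a - p)\<bar>" "D * \<rho> / (54 * R\<^sup>2) \<le> \<bar>cross2 e (b - p)\<bar>"
    "D * \<rho> / (54 * R\<^sup>2) \<le> \<bar>cross2 e (c - p)\<bar>" "D * \<rho> / (54 * R\<^sup>2) \<le> \<bar>cross2 e (d - p)\<bar>"
    "cross2 e (a - p) * cross2 e (b - p) < 0" "cross2 e (c - p) * cross2 e (d - p) < 0"
proof -
  define V where "V = b - a"
  define W where "W = d - c"
  define p where "p = a + (2/3) *\<^sub>R V"
  define e where "e = (c + (2/3) *\<^sub>R W) - p"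
  define Dc where "Dc = cross2 V (c - a)"
  define Dd where "Dd = cross2 V (d - a)"
  define Da where "Da = cross2 W (a - c)"
  define Db where "Db = cross2 W (b - c)"
  define N where "N = maxc W"
  have N: "0 < N" "\<rho> \<le> N" "N \<le> R" using \<rho> R(6) unfolding N_def W_def by auto
  have Dd: "D \<le> \<bar>Dd\<bar>" "\<bar>Dc\<bar> \<le> \<bar>Dd\<bar>" "\<bar>Da\<bar> \<le> \<bar>Db\<bar>"
    using D ord by (auto simp: Dc_def Dd_def Da_def Db_def V_def W_def)
  \<comment> \<open>The weight 2/3 falls on the determinant of larger modulus, so the two terms
    cannot cancel below a third of it.\<close>
  have eV: "cross2 e V = - (Dc / 3 + 2 * Dd / 3)" and eW: "cross2 e W = Da / 3 + 2 * Db / 3"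
    by (simp_all add: e_def p_def V_def W_def Dc_def Dd_def Da_def Db_def cross2_def field_simps)
  have vals: "cross2 e (a - p) = - (2/3) * cross2 e V" "cross2 e (b - p) = (1/3) * cross2 e V"
    "cross2 e (c - p) = - (2/3) * cross2 e W" "cross2 e (d - p) = (1/3) * cross2 e W"
    by (simp_all add: e_def p_def V_def W_def cross2_def field_simps)
  have geV: "\<bar>Dd\<bar> / 3 \<le> \<bar>cross2 e V\<bar>" and geW: "\<bar>Db\<bar> / 3 \<le> \<bar>cross2 e W\<bar>"
    unfolding eV eW using Dd(2,3) by linarith+
  \<comment> \<open>Expansion of \<open>V\<close> and \<open>d - a\<close> along \<open>W\<close>
    and its normal, where \<open>cross2 W (d - a) = - Da\<close> and
    \<open>cross2 W V = Db - Da\<close>. It turns the deviation of \<open>d\<close> from the line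
    \<open>ab\<close> into a lower bound for the deviation of \<open>b\<close> from the line
    \<open>cd\<close>.\<close>
  have id: "((fst W)\<^sup>2 + (snd W)\<^sup>2) * Dd
      = (fst V * fst W + snd V * snd W) * (- Da)
        - (fst (d - a) * fst W + snd (d - a) * snd W) * (Db - Da)"
    by (simp add: V_def W_def Dd_def Da_def Db_def cross2_def power2_eq_square algebra_simps)
  have inner_le: "\<bar>fst x * fst W + snd x * snd W\<bar> \<le> 2 * R * N" if "maxc x \<le> R" for x
  proof -
    have "\<bar>fst x * fst W\<bar> \<le> R * N" "\<bar>snd x * snd W\<bar> \<le> R * N"
      using that N order_trans[OF less_imp_le[OF N(1)] N(3)] unfolding abs_mult N_def maxc_def
      by (auto intro!: mult_mono)
    then show ?thesis by linarith
  qed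
  have "N * N * \<bar>Dd\<bar> \<le> ((fst W)\<^sup>2 + (snd W)\<^sup>2) * \<bar>Dd\<bar>"
    by (intro mult_right_mono) (auto simp: N_def maxc_def max_def power2_eq_square)
  also have "\<dots> = \<bar>((fst W)\<^sup>2 + (snd W)\<^sup>2) * Dd\<bar>" by (simp add: abs_mult)
  also have "\<dots> \<le> \<bar>(fst V * fst W + snd V * snd W) * (- Da)\<bar>
      + \<bar>(fst (d - a) * fst W + snd (d - a) * snd W) * (Db - Da)\<bar>"
    unfolding id by (rule abs_triangle_ineq4)
  also have "\<dots> \<le> (2 * R * N) * \<bar>Db\<bar> + (2 * R * N) * (2 * \<bar>Db\<bar>)"
    unfolding abs_mult
    using inner_le[of V] inner_le[of "d - a"] R(1,3) Dd(3) N
    by (intro add_mono mult_mono) (auto simp: V_def)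
  also have "\<dots> = N * (6 * R * \<bar>Db\<bar>)" by (simp add: algebra_simps)
  finally have "N * \<bar>Dd\<bar> \<le> 6 * R * \<bar>Db\<bar>" using N by (simp add: mult.assoc)
  moreover have "\<rho> * D \<le> N * \<bar>Dd\<bar>" using N \<rho> D Dd by (intro mult_mono) auto
  ultimately have Db: "\<rho> * D \<le> 6 * R * \<bar>Db\<bar>" by linarith
  have R0: "0 < R" using N by linarith
  have Dbpos: "0 < \<bar>Db\<bar>"
    using Db R0 mult_pos_pos[OF \<rho>(1) D(1)] by (metis abs_ge_zero less_eq_real_def mult_zero_right not_le)
  have e0: "0 < maxc e"
    using geV Dd(1) D(1) by (auto simp: maxc_def cross2_def less_max_iff_disj)
  have eR: "maxc e \<le> R"
  proof -
    \<comment> \<open>A convex combination: the weights are the products of 1/3, 2/3 for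
      \<open>c\<close>, \<open>d\<close> with 1/3, 2/3 for \<open>a\<close>,
      \<open>b\<close>.\<close>
    have "e = (1/9) *\<^sub>R (c - a) + (2/9) *\<^sub>R (d - a) + (2/9) *\<^sub>R (c - b) + (4/9) *\<^sub>R (d - b)"
      by (simp add: e_def p_def V_def W_def prod_eq_iff field_simps)
    then have fe: "fst e = 1/9 * fst (c - a) + 2/9 * fst (d - a) + 2/9 * fst (c - b) + 4/9 * fst (d - b)"
      and se: "snd e = 1/9 * snd (c - a) + 2/9 * snd (d - a) + 2/9 * snd (c - b) + 4/9 * snd (d - b)"
      by (simp_all only: fst_add snd_add fst_scaleR snd_scaleR real_scaleR_def)
    have "\<bar>1/9 * x + 2/9 * y + 2/9 * z + 4/9 * w\<bar> \<le> R"
      if "\<bar>x\<bar> \<le> R" "\<bar>y\<bar> \<le> R" "\<bar>z\<bar> \<le> R" "\<bar>w\<bar> \<le> R" for x y z w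
      using that by linarith
    then show ?thesis unfolding maxc_def fe se using R(2-5) by (simp only: maxc_def max.bounded_iff simp_thms)
  qed
  define e' where "e' = (1 / maxc e) *\<^sub>R e"
  have e': "maxc e' = 1" "cross2 e' x = cross2 e x / maxc e" for x
    using e0 by (auto simp: e'_def maxc_def abs_mult cross2_linear max_def field_simps)
  \<comment> \<open>Here 54 is 9 times 6: one third from \<open>geV\<close> and \<open>geW\<close>,
    one third because \<open>p\<close> and \<open>p + e\<close> cut their segments in the ratio 2:1,
    and \<open>6 * R\<close> from comparing \<open>Dd\<close> with \<open>Db\<close>. The other
    \<open>R\<close> bounds \<open>maxc e\<close> in the normalization.\<close>
  let ?m = "D * \<rho> / (54 * R\<^sup>2)"
  have m: "?m \<le> \<bar>Dd\<bar> / 9 / maxc e" "?m \<le> \<bar>Db\<bar> / 9 / maxc e"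
  proof -
    have "D * \<rho> \<le> \<bar>Dd\<bar> * (6 * R)" using Dd(1) N D \<rho> by (intro mult_mono) auto
    then have "?m \<le> \<bar>Dd\<bar> / 9 / R" using R0 by (simp add: field_simps power2_eq_square)
    also have "\<dots> \<le> \<bar>Dd\<bar> / 9 / maxc e" using e0 eR by (intro divide_left_mono) auto
    finally show "?m \<le> \<bar>Dd\<bar> / 9 / maxc e" .
    have "?m \<le> \<bar>Db\<bar> / 9 / R" using R0 Db by (simp add: field_simps power2_eq_square)
    also have "\<dots> \<le> \<bar>Db\<bar> / 9 / maxc e" using e0 eR by (intro divide_left_mono) auto
    finally show "?m \<le> \<bar>Db\<bar> / 9 / maxc e" .
  qed
  have q: "\<bar>Dd\<bar> / 9 / maxc e \<le> \<bar>(1/3) * cross2 e V\<bar> / maxc e" "\<bar>Db\<bar> / 9 / maxc e \<le> \<bar>(1/3) * cross2 e W\<bar> / maxc e"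
    "\<bar>(1/3) * cross2 e V\<bar> / maxc e \<le> \<bar>- (2/3) * cross2 e V\<bar> / maxc e"
    "\<bar>(1/3) * cross2 e W\<bar> / maxc e \<le> \<bar>- (2/3) * cross2 e W\<bar> / maxc e"
    by (intro divide_right_mono less_imp_le[OF e0]; use geV geW in \<open>simp add: abs_mult\<close>)+
  have nz: "cross2 e V \<noteq> 0" "cross2 e W \<noteq> 0" using geV geW Dd(1) D(1) Dbpos by auto
  have neg: "(- (2/3) * x) / y * ((1/3) * x / y) < 0" if "x \<noteq> 0" "0 < y" for x y :: real
  proof -
    have "0 < x * x" using \<open>x \<noteq> 0\<close> by (metis not_real_square_gt_zero)
    then show ?thesis using that by (simp add: field_simps)
  qed
  show ?thesis
  proof (rule that[of e' p])
    show "maxc e' = 1" by (rule e'(1))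
  qed (use m q neg[OF nz(1) e0] neg[OF nz(2) e0] e0 in \<open>simp_all add: e'(2) vals abs_mult\<close>)
qed

lemma maxc_minus: "maxc (x - y) = maxc (y - x)"
  by (simp add: maxc_def abs_minus_commute)

text \<open>Exchanging the endpoints of a pair preserves the absolute determinants of points against
  its line, and the conclusion as well, so the orderings assumed in
  \<open>separating_line_aux\<close> can be arranged.\<close>

lemma separating_line:
  fixes a b c d :: "real \<times> real"
  assumes R: "maxc (b - a) \<le> R" "maxc (c - a) \<le> R" "maxc (d - a) \<le> R" "maxc (c - b) \<le> R" "maxc (d - b) \<le> R"
      "maxc (d - c) \<le> R"
    and \<rho>: "0 < \<rho>" "\<rho> \<le> maxc (d - c)"
    and D: "0 < D" "D \<le> \<bar>cross2 (b - a) (c - a)\<bar> \<or> D \<le> \<bar>cross2 (b - a) (d - a)\<bar>"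
  shows "\<exists>e p. maxc e = 1 \<and>
    D * \<rho> / (54 * R\<^sup>2) \<le> \<bar>cross2 e (a - p)\<bar> \<and> D * \<rho> / (54 * R\<^sup>2) \<le> \<bar>cross2 e (b - p)\<bar> \<and>
    D * \<rho> / (54 * R\<^sup>2) \<le> \<bar>cross2 e (c - p)\<bar> \<and> D * \<rho> / (54 * R\<^sup>2) \<le> \<bar>cross2 e (d - p)\<bar> \<and>
    cross2 e (a - p) * cross2 e (b - p) < 0 \<and> cross2 e (c - p) * cross2 e (d - p) < 0"
    (is "?P a b c d")
proof -
  have swap: "\<bar>cross2 (a - b) (x - b)\<bar> = \<bar>cross2 (b - a) (x - a)\<bar>" "\<bar>cross2 (c - d) (x - d)\<bar> = \<bar>cross2 (d - c) (x - c)\<bar>" for x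
    by (simp_all add: cross2_def algebra_simps abs_minus_commute)
  have A: "?P a b c' d'"
    if c': "(c', d') = (c, d) \<or> (c', d') = (d, c)" and
      o: "\<bar>cross2 (b - a) (c' - a)\<bar> \<le> \<bar>cross2 (b - a) (d' - a)\<bar>" for c' d'
  proof (cases "\<bar>cross2 (d' - c') (a - c')\<bar> \<le> \<bar>cross2 (d' - c') (b - c')\<bar>")
    case True
    show ?thesis
      by (rule separating_line_aux[of b a R c' d' \<rho> D])
        (use True o c' R \<rho> D in \<open>auto simp: maxc_minus\<close>)
  next
    case False
    show ?thesis
      by (rule separating_line_aux[of a b R c' d' \<rho> D])
        (use False o c' R \<rho> D in \<open>auto simp: maxc_minus swap mult.commute\<close>)
  qed
  show ?thesis
  proof (cases "\<bar>cross2 (b - a) (c - a)\<bar> \<le> \<bar>cross2 (b - a) (d - a)\<bar>")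
    case True
    then show ?thesis using A[of c d] by simp
  next
    case False
    then have "?P a b d c" using A[of d c] by simp
    then show ?thesis by (metis mult.commute)
  qed
qed

section \<open>Hyperplanes of small slope separating two pairs in dimension \<open>n\<close>\<close>

definition separates :: "('a \<Rightarrow> real) \<Rightarrow> real \<Rightarrow> 'a \<Rightarrow> 'a \<Rightarrow> bool" where
  "separates g \<eta> a b \<longleftrightarrow> g a \<le> - \<eta> \<and> \<eta> \<le> g b \<or> \<eta> \<le> g a \<and> g b \<le> - \<eta>"

definition line_through :: "real^'n \<Rightarrow> real^'n \<Rightarrow> (real^'n) set" where
  "line_through a b = {a + t *\<^sub>R (b - a) | t. True}"

lemma separatesI:
  assumes "\<eta> \<le> \<bar>g a\<bar>" "\<eta> \<le> \<bar>g b\<bar>" "g a * g b < 0"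
  shows "separates g \<eta> a b"
  using assms by (auto simp: separates_def abs_if mult_less_0_iff split: if_splits)

lemma exists_large_component:
  fixes x :: "real^'n"
  obtains i where "norm x / CARD('n) \<le> \<bar>x $ i\<bar>"
proof (rule ccontr)
  assume "\<not> thesis"
  then have "\<bar>x $ i\<bar> < norm x / CARD('n)" for i using that not_le by blast
  then have "(\<Sum>i\<in>UNIV. \<bar>x $ i\<bar>) < (\<Sum>i\<in>(UNIV :: 'n set). norm x / CARD('n))"
    by (intro sum_strict_mono) auto
  then show False using norm_le_l1_cart[of x] by simp
qed

text \<open>Projection to the \<open>(j, i)\<close> plane reduces this to
  \<open>separating_line\<close>. Depending on which component of \<open>e\<close> has modulus 1,
  the line is a graph over one axis or the other; this is why the conclusion quantifies over the
  indices anew.\<close>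

lemma four_points_plane:
  fixes a b c d :: "real^'n"
  assumes R: "norm (b - a) \<le> R" "norm (c - a) \<le> R" "norm (d - a) \<le> R" "norm (c - b) \<le> R" "norm (d - b) \<le> R"
      "norm (d - c) \<le> R"
    and \<rho>: "0 < \<rho>" "\<rho> \<le> \<bar>(d - c) $ i\<bar> \<or> \<rho> \<le> \<bar>(d - c) $ j\<bar>"
    and D: "0 < D" "D \<le> \<bar>(b - a) $ j * (c - a) $ i - (b - a) $ i * (c - a) $ j\<bar> \<or>
      D \<le> \<bar>(b - a) $ j * (d - a) $ i - (b - a) $ i * (d - a) $ j\<bar>"
  shows "\<exists>i j m q. \<bar>m\<bar> \<le> 1 \<and> separates (\<lambda>x. x $ i - m * x $ j - q) (D * \<rho> / (54 * R\<^sup>2)) a b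
    \<and> separates (\<lambda>x. x $ i - m * x $ j - q) (D * \<rho> / (54 * R\<^sup>2)) c d"
proof -
  define \<pi> :: "real^'n \<Rightarrow> real \<times> real" where "\<pi> x = (x $ j, x $ i)" for x
  have diff: "\<pi> x - \<pi> y = ((x - y) $ j, (x - y) $ i)" for x y by (simp add: \<pi>_def)
  have le: "maxc (\<pi> x - \<pi> y) \<le> R" if "norm (x - y) \<le> R" for x y
    unfolding maxc_def diff using that component_le_norm_cart[of "x - y" i] component_le_norm_cart[of "x - y" j] by auto
  obtain e p where e: "maxc e = 1"
    "D * \<rho> / (54 * R\<^sup>2) \<le> \<bar>cross2 e (\<pi> a - p)\<bar>" "D * \<rho> / (54 * R\<^sup>2) \<le> \<bar>cross2 e (\<pi> b - p)\<bar>"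
    "D * \<rho> / (54 * R\<^sup>2) \<le> \<bar>cross2 e (\<pi> c - p)\<bar>" "D * \<rho> / (54 * R\<^sup>2) \<le> \<bar>cross2 e (\<pi> d - p)\<bar>"
    "cross2 e (\<pi> a - p) * cross2 e (\<pi> b - p) < 0" "cross2 e (\<pi> c - p) * cross2 e (\<pi> d - p) < 0"
  proof -
    have "\<exists>e p. maxc e = 1 \<and>
      D * \<rho> / (54 * R\<^sup>2) \<le> \<bar>cross2 e (\<pi> a - p)\<bar> \<and> D * \<rho> / (54 * R\<^sup>2) \<le> \<bar>cross2 e (\<pi> b - p)\<bar> \<and>
      D * \<rho> / (54 * R\<^sup>2) \<le> \<bar>cross2 e (\<pi> c - p)\<bar> \<and> D * \<rho> / (54 * R\<^sup>2) \<le> \<bar>cross2 e (\<pi> d - p)\<bar> \<and>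
      cross2 e (\<pi> a - p) * cross2 e (\<pi> b - p) < 0 \<and> cross2 e (\<pi> c - p) * cross2 e (\<pi> d - p) < 0"
    proof (rule separating_line)
      show "\<rho> \<le> maxc (\<pi> d - \<pi> c)" unfolding maxc_def diff using \<rho>(2) by auto
      show "D \<le> \<bar>cross2 (\<pi> b - \<pi> a) (\<pi> c - \<pi> a)\<bar> \<or> D \<le> \<bar>cross2 (\<pi> b - \<pi> a) (\<pi> d - \<pi> a)\<bar>"
        unfolding cross2_def diff using D(2) by simp
    qed (use le R \<rho> D in auto)
    then show ?thesis using that by blast
  qed
  show ?thesis
  proof (cases "\<bar>fst e\<bar> = 1")
    case True
    define m where "m = snd e / fst e"
    define q where "q = snd p - m * fst p"
    have "\<bar>m\<bar> \<le> 1" using e(1) True by (auto simp: m_def maxc_def)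
    moreover have g: "x $ i - m * x $ j - q = cross2 e (\<pi> x - p) / fst e" for x
      using True by (auto simp: m_def q_def \<pi>_def cross2_def field_simps)
    have "\<bar>cross2 e (\<pi> x - p) / fst e\<bar> = \<bar>cross2 e (\<pi> x - p)\<bar>" for x using True by simp
    moreover have "(u / fst e) * (v / fst e) = u * v" for u v
    proof -
      have "fst e * fst e = 1" using True by (metis abs_mult_self_eq mult.right_neutral)
      then show ?thesis by (simp add: field_simps)
    qed
    ultimately show ?thesis
      using e(2-) by (intro exI[of _ i] exI[of _ j] exI[of _ m] exI[of _ q] conjI separatesI) (simp_all only: g)
  next
    case False
    then have s: "\<bar>snd e\<bar> = 1" "\<bar>fst e\<bar> \<le> 1" using e(1) by (auto simp: maxc_def max_def split: if_splits)
    define m where "m = fst e / snd e"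
    define q where "q = fst p - m * snd p"
    have "\<bar>m\<bar> \<le> 1" using s by (auto simp: m_def)
    moreover have g: "x $ j - m * x $ i - q = - (cross2 e (\<pi> x - p) / snd e)" for x
      using s by (auto simp: m_def q_def \<pi>_def cross2_def field_simps)
    have "\<bar>- (cross2 e (\<pi> x - p) / snd e)\<bar> = \<bar>cross2 e (\<pi> x - p)\<bar>" for x using s by simp
    moreover have "- (u / snd e) * - (v / snd e) = u * v" for u v
    proof -
      have "snd e * snd e = 1" using s by (metis abs_mult_self_eq mult.right_neutral)
      then show ?thesis by (simp add: field_simps)
    qed
    ultimately show ?thesis
      using e(2-) by (intro exI[of _ j] exI[of _ i] exI[of _ m] exI[of _ q] conjI separatesI) (simp_all only: g)
  qed
qed

text \<open>If the projection of \<open>cd\<close> to the dominant coordinate of \<open>ab\<close> is short, then \<open>ab\<close> and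
  \<open>cd\<close> are transversal in some coordinate plane; otherwise use the plane in which \<open>c\<close> or \<open>d\<close>
  deviates most from the line \<open>ab\<close>.\<close>
lemma four_points:
  fixes a b c d :: "real^'n"
  assumes R: "norm (b - a) \<le> R" "norm (c - a) \<le> R" "norm (d - a) \<le> R" "norm (c - b) \<le> R" "norm (d - b) \<le> R"
      "norm (d - c) \<le> R"
    and \<rho>: "0 < \<rho>" "\<rho> \<le> norm (b - a)" "\<rho> \<le> norm (d - c)"
    and \<delta>: "0 < \<delta>" "\<delta> \<le> infdist c (line_through a b) \<or> \<delta> \<le> infdist d (line_through a b)"
  shows "\<exists>i j m q. \<bar>m\<bar> \<le> 1 \<and>
     separates (\<lambda>x. x $ i - m * x $ j - q) (\<delta> * (\<rho> / R) ^ 4 / (432 * real CARD('n) ^ 4)) a b \<and>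
     separates (\<lambda>x. x $ i - m * x $ j - q) (\<delta> * (\<rho> / R) ^ 4 / (432 * real CARD('n) ^ 4)) c d"
proof -
  define n where "n = real CARD('n)"
  have n: "1 \<le> n" using zero_less_card_finite[where 'a='n] unfolding n_def by linarith
  have R0: "0 < R" "\<rho> \<le> R" using R \<rho> by linarith+
  obtain j where j: "norm (b - a) / n \<le> \<bar>(b - a) $ j\<bar>"
    unfolding n_def by (rule exists_large_component)
  have Vj: "\<rho> / n \<le> \<bar>(b - a) $ j\<bar>"
    using j \<rho>(2) n by (smt (verit) divide_right_mono)
  have Vj0: "0 < \<bar>(b - a) $ j\<bar>" using Vj \<rho>(1) n by (smt (verit) divide_pos_pos)
  \<comment> \<open>With this threshold \<open>R * \<rho>'\<close> is half of
    \<open>(\<rho> / n)\<^sup>2\<close>: if the \<open>j\<close>-component of \<open>cd\<close> is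
    below it, it cannot cancel the main term of the determinant of the two directions.\<close>
  define \<rho>' where "\<rho>' = \<rho>\<^sup>2 / (2 * n\<^sup>2 * R)"
  define D where "D = \<rho>\<^sup>2 * \<delta> / (4 * n\<^sup>2 * R)"
  have margin: "D * \<rho>' / (54 * R\<^sup>2) = \<delta> * (\<rho> / R) ^ 4 / (432 * real CARD('n) ^ 4)"
    by (simp add: D_def \<rho>'_def n_def power2_eq_square power4_eq_xxxx field_simps)
  have pos: "0 < \<rho>'" "0 < D" using \<rho> n R0 \<delta> by (auto simp: D_def \<rho>'_def)
  have rr: "\<rho>' \<le> \<rho> / n"
  proof -
    have "1 * \<rho> \<le> (2 * n) * R" using R0 n \<rho>(1) by (intro mult_mono) auto
    then have "\<rho> * \<rho> \<le> \<rho> * ((2 * n) * R)" using \<rho>(1) by (intro mult_left_mono) auto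
    then show ?thesis using n R0 by (simp add: \<rho>'_def power2_eq_square field_simps)
  qed
  have dev: "\<exists>i. D \<le> \<bar>(b - a) $ j * (x - a) $ i - (b - a) $ i * (x - a) $ j\<bar>"
    if x: "\<delta> \<le> infdist x (line_through a b)" for x
  proof -
    \<comment> \<open>This \<open>t\<close> makes the \<open>j\<close>-th component of
      \<open>y\<close> vanish, so the determinant becomes the product of \<open>(b - a) $ j\<close>
      and \<open>y $ i\<close>.\<close>
    define t where "t = (x - a) $ j / (b - a) $ j"
    define y where "y = x - (a + t *\<^sub>R (b - a))"
    have "infdist x (line_through a b) \<le> dist x (a + t *\<^sub>R (b - a))"
      by (rule infdist_le) (auto simp: line_through_def)
    then have "\<delta> \<le> norm y" using x by (simp add: dist_norm y_def)
    obtain i where i: "norm y / n \<le> \<bar>y $ i\<bar>" unfolding n_def by (rule exists_large_component)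
    have "t * (b - a) $ j = (x - a) $ j" using Vj0 by (simp add: t_def)
    moreover have "(b - a) $ j * y $ i = (b - a) $ j * (x - a) $ i - (b - a) $ i * (t * (b - a) $ j)"
      by (simp add: y_def algebra_simps)
    ultimately have "(b - a) $ j * y $ i = (b - a) $ j * (x - a) $ i - (b - a) $ i * (x - a) $ j"
      by simp
    then have "\<bar>(b - a) $ j * (x - a) $ i - (b - a) $ i * (x - a) $ j\<bar> = \<bar>(b - a) $ j\<bar> * \<bar>y $ i\<bar>"
      by (metis abs_mult)
    moreover have "(\<rho> / n) * (\<delta> / n) \<le> \<bar>(b - a) $ j\<bar> * \<bar>y $ i\<bar>"
    proof (intro mult_mono)
      show "\<delta> / n \<le> \<bar>y $ i\<bar>" using i \<open>\<delta> \<le> norm y\<close> n by (smt (verit) divide_right_mono)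
    qed (use Vj \<rho> \<delta> n in auto)
    moreover have "D \<le> (\<rho> / n) * (\<delta> / n)"
    proof -
      have "\<rho> * (\<rho> * \<delta>) \<le> (4 * R) * (\<rho> * \<delta>)" using R0 \<rho> \<delta> by (intro mult_right_mono) auto
      then show ?thesis using n R0 by (simp add: D_def power2_eq_square field_simps)
    qed
    ultimately show ?thesis by (intro exI[of _ i]) linarith
  qed
  show ?thesis
  proof (cases "\<rho>' \<le> \<bar>(d - c) $ j\<bar>")
    case True
    obtain i where "D \<le> \<bar>(b - a) $ j * (c - a) $ i - (b - a) $ i * (c - a) $ j\<bar> \<or>
      D \<le> \<bar>(b - a) $ j * (d - a) $ i - (b - a) $ i * (d - a) $ j\<bar>"
      using \<delta>(2) dev by blast
    then show ?thesis
      unfolding margin[symmetric] using True pos by (intro four_points_plane[OF R]) auto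
  next
    case False
    obtain i where i: "norm (d - c) / n \<le> \<bar>(d - c) $ i\<bar>" unfolding n_def by (rule exists_large_component)
    have Wi: "\<rho> / n \<le> \<bar>(d - c) $ i\<bar>"
      using i \<rho>(3) n by (smt (verit) divide_right_mono)
    have "(\<rho> / n) * (\<rho> / n) \<le> \<bar>(b - a) $ j\<bar> * \<bar>(d - c) $ i\<bar>"
      using Vj Wi \<rho> n by (intro mult_mono) auto
    moreover have "\<bar>(b - a) $ i\<bar> * \<bar>(d - c) $ j\<bar> \<le> R * \<rho>'"
      using False R(1) component_le_norm_cart[of "b - a" i] pos R0 by (intro mult_mono) auto
    moreover have "R * \<rho>' = (\<rho> / n) * (\<rho> / n) / 2"
      using R0 n by (simp add: \<rho>'_def power2_eq_square field_simps)
    ultimately have "(\<rho> / n) * (\<rho> / n) / 2 \<le> \<bar>(b - a) $ j * (d - c) $ i - (b - a) $ i * (d - c) $ j\<bar>"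
      by (simp flip: abs_mult)
    \<comment> \<open>The determinant of the two directions is the difference of those of
      \<open>d\<close> and \<open>c\<close>. As its modulus is at least \<open>2 * D\<close>, one of
      the two has modulus at least \<open>D\<close>.\<close>
    moreover have "(b - a) $ j * (d - c) $ i - (b - a) $ i * (d - c) $ j =
        ((b - a) $ j * (d - a) $ i - (b - a) $ i * (d - a) $ j) - ((b - a) $ j * (c - a) $ i - (b - a) $ i * (c - a) $ j)"
      by (simp add: algebra_simps)
    moreover have "2 * D \<le> (\<rho> / n) * (\<rho> / n) / 2"
    proof -
      have a: "a \<in> line_through a b" by (force simp: line_through_def)
      have "\<delta> \<le> R"
        using \<delta>(2) infdist_le[OF a, of c] infdist_le[OF a, of d] R(2,3) by (auto simp: dist_norm)
      then have "\<rho> * \<rho> * \<delta> \<le> \<rho> * \<rho> * R" by (intro mult_left_mono) auto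
      then show ?thesis using n R0 by (simp add: D_def power2_eq_square field_simps)
    qed
    ultimately have "D \<le> \<bar>(b - a) $ j * (c - a) $ i - (b - a) $ i * (c - a) $ j\<bar> \<or>
      D \<le> \<bar>(b - a) $ j * (d - a) $ i - (b - a) $ i * (d - a) $ j\<bar>"
      by linarith
    then show ?thesis
      unfolding margin[symmetric] using rr Wi pos by (intro four_points_plane[OF R]) auto
  qed
qed

section \<open>The traveling salesman estimate\<close>

text \<open>Follow the curve from \<open>y\<close> towards \<open>w\<close>, forwards or backwards
  in the parameter, and stop when the distance to \<open>y\<close> first reaches
  \<open>\<rho>\<close>.\<close>

lemma initial_arc:
  fixes f :: "real \<Rightarrow> 'a::metric_space"
  assumes f: "continuous_on {0..1} f" and y: "y \<in> f ` {0..1}" and w: "w \<in> f ` {0..1}"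
    and \<rho>: "0 \<le> \<rho>" "\<rho> \<le> dist y w"
  obtains P y' where "P \<subseteq> f ` {0..1}" "connected P" "y \<in> P" "y' \<in> P" "dist y y' = \<rho>" "P \<subseteq> cball y \<rho>"
proof -
  obtain s t where s: "s \<in> {0..1}" "y = f s" and t: "t \<in> {0..1}" "w = f t" using y w by blast
  have seg: "closed_segment s u \<subseteq> {0..1}" if "u \<in> {0..1}" for u
    by (intro closed_segment_subset s that convex_real_interval)
  have cont: "continuous_on (closed_segment s u) (\<lambda>\<tau>. dist (f s) (f \<tau>))" if "u \<in> {0..1}" for u
    by (intro continuous_intros continuous_on_subset[OF f seg[OF that]])
  define A where "A = closed_segment s t \<inter> (\<lambda>\<tau>. dist (f s) (f \<tau>)) -` {\<rho>..}"
  have "closed A"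
    unfolding A_def using continuous_on_closed_vimage[OF closed_segment] cont[OF t(1)]
    by (metis Int_commute closed_atLeast)
  then have "compact A"
    unfolding A_def by (metis Int_lower1 bounded_closed_segment bounded_subset compact_eq_bounded_closed)
  moreover have "t \<in> A" using \<rho> s t by (simp add: A_def)
  moreover have "continuous_on A (\<lambda>\<tau>. \<bar>\<tau> - s\<bar>)" by (intro continuous_intros)
  ultimately obtain u where u: "u \<in> A" "\<And>\<tau>. \<tau> \<in> A \<Longrightarrow> \<bar>u - s\<bar> \<le> \<bar>\<tau> - s\<bar>"
    using continuous_attains_inf[of A "\<lambda>\<tau>. \<bar>\<tau> - s\<bar>"] by blast
  have ut: "u \<in> closed_segment s t" "\<rho> \<le> dist (f s) (f u)" using u(1) by (auto simp: A_def)
  have u01: "u \<in> {0..1}" using ut seg[OF t(1)] by blast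
  have sub: "closed_segment s u \<subseteq> closed_segment s t" using ut by (simp add: subset_closed_segment)
  have less: "dist (f s) (f \<tau>) < \<rho> \<or> \<tau> = u" if \<tau>: "\<tau> \<in> closed_segment s u" for \<tau>
  proof (rule disjCI, rule ccontr)
    assume "\<tau> \<noteq> u" "\<not> dist (f s) (f \<tau>) < \<rho>"
    then have "\<tau> \<in> A" using sub \<tau> by (auto simp: A_def)
    then show False using u(2)[of \<tau>] \<tau> \<open>\<tau> \<noteq> u\<close> by (auto simp: closed_segment_eq_real_ivl split: if_splits)
  qed
  have "connected ((\<lambda>\<tau>. dist (f s) (f \<tau>)) ` closed_segment s u)"
    by (intro connected_continuous_image cont[OF u01] connected_segment)
  then have "{dist (f s) (f s)..dist (f s) (f u)} \<subseteq> (\<lambda>\<tau>. dist (f s) (f \<tau>)) ` closed_segment s u"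
    by (intro connected_contains_Icc) auto
  then have "\<rho> \<in> (\<lambda>\<tau>. dist (f s) (f \<tau>)) ` closed_segment s u" using \<rho> ut by auto
  then have du: "dist (f s) (f u) = \<rho>" using less by fastforce
  show ?thesis
  proof (rule that[of "f ` closed_segment s u" "f u"])
    show "connected (f ` closed_segment s u)"
      by (intro connected_continuous_image continuous_on_subset[OF f seg[OF u01]] connected_segment)
    show "f ` closed_segment s u \<subseteq> cball y \<rho>" using less du s(2) by fastforce
  qed (use seg[OF u01] s du in auto)
qed

lemma separates_imp_zero:
  fixes g :: "'a::topological_space \<Rightarrow> real"
  assumes "connected P" "continuous_on P g" "a \<in> P" "b \<in> P" "separates g \<eta> a b" "0 \<le> \<eta>"
  obtains s where "s \<in> P" "g s = 0"
proof -
  have "connected (g ` P)" using assms by (intro connected_continuous_image)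
  then have "0 \<in> g ` P"
    using connected_contains_Icc[of "g ` P" "g a" "g b"] connected_contains_Icc[of "g ` P" "g b" "g a"] assms(3-6)
    by (force simp: separates_def)
  then show ?thesis using that by auto
qed

text \<open>The pair \<open>(m', q')\<close> stands for the hyperplane \<open>x\<^sub>i - m' x\<^sub>j = q'\<close>. Shearing the parameter box by \<open>z\<close>
  makes its size independent of the position of \<open>y\<close>.\<close>
definition double_hits :: "(real^'n) set \<Rightarrow> real^'n \<Rightarrow> real \<Rightarrow> real \<Rightarrow> real \<Rightarrow> bool" where
  "double_hits \<Gamma> y r \<rho> \<delta> \<longleftrightarrow> (\<exists>i j m z q. \<bar>m\<bar> \<le> 1 \<and> (\<forall>m' q'. (m', q') \<in> strip m (\<delta> / r) z q \<delta> \<longrightarrow>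
     (\<exists>s\<in>\<Gamma>. \<exists>s'\<in>\<Gamma>. dist y s \<le> \<rho> \<and> dist y s' \<le> \<rho> \<and> r / 4 \<le> dist s s' \<and>
        s $ i - m' * s $ j = q' \<and> s' $ i - m' * s' $ j = q')))"

lemma double_hits_mono:
  assumes "double_hits \<Gamma> y r \<rho> \<delta>" "\<delta>' \<le> \<delta>" "0 < r"
  shows "double_hits \<Gamma> y r \<rho> \<delta>'"
proof -
  have "strip m (\<delta>' / r) z q \<delta>' \<subseteq> strip m (\<delta> / r) z q \<delta>" for m z q
    using assms(2) divide_right_mono[OF assms(2), of r] assms(3) by (auto simp: strip_def)
  then show ?thesis using assms(1) unfolding double_hits_def by (meson subsetD)
qed

text \<open>\<open>four_points\<close> yields one hyperplane separating both endpoint pairs with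
  margin \<open>\<eta>\<close>. All hyperplanes with parameters close enough still separate them,
  and by the intermediate value theorem each crosses both connected arcs.\<close>

lemma double_hits_of_arcs:
  fixes \<Gamma> :: "(real^'n) set"
  assumes "0 < r" "1 \<le> A"
    and P: "P \<subseteq> \<Gamma> \<inter> cball y ((A + 1) * r)" "connected P" "a \<in> P" "b \<in> P" "dist a b = r / 8"
    and Q: "Q \<subseteq> \<Gamma> \<inter> cball y ((A + 1) * r)" "connected Q" "c \<in> Q" "d \<in> Q" "dist c d = r / 8"
    and sep: "\<And>s s'. s \<in> P \<Longrightarrow> s' \<in> Q \<Longrightarrow> r / 4 \<le> dist s s'"
    and \<delta>: "0 < \<delta>" "\<delta> \<le> infdist c (line_through a b) \<or> \<delta> \<le> infdist d (line_through a b)"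
  shows "double_hits \<Gamma> y r ((A + 1) * r) ((1 / (16 * (A + 1))) ^ 4 / (432 * real CARD('n) ^ 4) / (2 * (A + 2)) * \<delta>)"
proof -
  define R where "R = 2 * ((A + 1) * r)"
  have ball: "norm (x - x') \<le> R" if "x \<in> P \<union> Q" "x' \<in> P \<union> Q" for x x'
  proof -
    have "dist y x \<le> (A + 1) * r" "dist y x' \<le> (A + 1) * r" using that P(1) Q(1) by auto
    then show ?thesis using dist_triangle3[of x x' y] by (simp add: R_def dist_norm)
  qed
  define \<eta> where "\<eta> = \<delta> * (r / 8 / R) ^ 4 / (432 * real CARD('n) ^ 4)"
  \<comment> \<open>The divisor \<open>2 * (A + 2)\<close> makes the total variation
    \<open>\<kappa> * (A + 2)\<close> over the ball half of the margin
    \<open>\<eta>\<close>.\<close>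
  define \<kappa> where "\<kappa> = (1 / (16 * (A + 1))) ^ 4 / (432 * real CARD('n) ^ 4) / (2 * (A + 2)) * \<delta>"
  have "r / 8 / R = r / (16 * (A + 1) * r)" by (simp add: R_def)
  also have "\<dots> = 1 / (16 * (A + 1))" using assms(1) by simp
  finally have "r / 8 / R = 1 / (16 * (A + 1))" .
  then have \<eta>: "\<eta> = 2 * (A + 2) * \<kappa>" using assms(2) by (simp add: \<eta>_def \<kappa>_def)
  have \<kappa>0: "0 < \<kappa>" using \<delta> assms(2) by (simp add: \<kappa>_def)
  have "\<exists>i j m q. \<bar>m\<bar> \<le> 1 \<and> separates (\<lambda>x. x $ i - m * x $ j - q) \<eta> a b \<and>
     separates (\<lambda>x. x $ i - m * x $ j - q) \<eta> c d"
    unfolding \<eta>_def using P Q \<delta> assms(1)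
    by (intro four_points ball) (auto simp: dist_norm norm_minus_commute)
  then obtain i j m q where m: "\<bar>m\<bar> \<le> 1" and sep2: "separates (\<lambda>x. x $ i - m * x $ j - q) \<eta> a b"
     "separates (\<lambda>x. x $ i - m * x $ j - q) \<eta> c d" by blast
  \<comment> \<open>The offset is measured over \<open>y\<close>, so a change of slope is multiplied
    by \<open>x$j - y$j\<close>, which is at most \<open>(A + 1) * r\<close>, and not by
    \<open>x$j\<close> itself.\<close>
  have hit: "\<exists>s\<in>\<Gamma>. \<exists>s'\<in>\<Gamma>. dist y s \<le> (A + 1) * r \<and> dist y s' \<le> (A + 1) * r \<and> r / 4 \<le> dist s s' \<and>
        s $ i - m' * s $ j = q' \<and> s' $ i - m' * s' $ j = q'"
    if s: "(m', q') \<in> strip m (\<kappa> / r) (y $ j) (q + m * y $ j) \<kappa>" for m' q'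
  proof -
    have near: "\<bar>(x $ i - m' * x $ j - q') - (x $ i - m * x $ j - q)\<bar> \<le> \<eta>" if x: "x \<in> P \<union> Q" for x
    proof -
      have "norm (x - y) \<le> (A + 1) * r" using x P(1) Q(1) by (auto simp: dist_norm norm_minus_commute)
      then have "\<bar>x $ j - y $ j\<bar> \<le> (A + 1) * r" using component_le_norm_cart[of "x - y" j] by simp
      moreover have "\<bar>m' - m\<bar> \<le> \<kappa> / r" using s by (simp add: strip_def)
      ultimately have "\<bar>m' - m\<bar> * \<bar>x $ j - y $ j\<bar> \<le> \<kappa> / r * ((A + 1) * r)"
        using \<kappa>0 assms(1) by (intro mult_mono) auto
      then have 1: "\<bar>(m' - m) * (x $ j - y $ j)\<bar> \<le> \<kappa> * (A + 1)"
        using assms(1) by (simp add: abs_mult)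
      have 2: "\<bar>q' + m' * y $ j - (q + m * y $ j)\<bar> \<le> \<kappa>" using s by (simp add: strip_def)
      have "(x $ i - m' * x $ j - q') - (x $ i - m * x $ j - q)
          = - ((m' - m) * (x $ j - y $ j)) - (q' + m' * y $ j - (q + m * y $ j))"
        by (simp add: algebra_simps)
      then have "\<bar>(x $ i - m' * x $ j - q') - (x $ i - m * x $ j - q)\<bar> \<le> \<kappa> * (A + 1) + \<kappa>"
        using 1 2 by linarith
      also have "\<dots> = \<kappa> * (A + 2)" by (simp add: algebra_simps)
      also have "\<dots> \<le> \<eta>" unfolding \<eta> using \<kappa>0 assms(2) by simp
      finally show ?thesis .
    qed
    have sep0: "separates (\<lambda>x. x $ i - m' * x $ j - q') 0 u v"
      if "separates (\<lambda>x. x $ i - m * x $ j - q) \<eta> u v" "u \<in> P \<union> Q" "v \<in> P \<union> Q" for u v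
      using that(1) near[OF that(2)] near[OF that(3)] unfolding separates_def by linarith
    have cont: "continuous_on X (\<lambda>x::real^'n. x $ i - m' * x $ j - q')" for X
      by (intro continuous_intros)
    obtain s where s: "s \<in> P" "s $ i - m' * s $ j - q' = 0"
      using separates_imp_zero[OF P(2) cont P(3,4) sep0[OF sep2(1)]] P(3,4) by auto
    obtain s' where s': "s' \<in> Q" "s' $ i - m' * s' $ j - q' = 0"
      using separates_imp_zero[OF Q(2) cont Q(3,4) sep0[OF sep2(2)]] Q(3,4) by auto
    show ?thesis
      using s s' sep[OF s(1) s'(1)] P(1) Q(1) by (intro bexI[of _ s] bexI[of _ s']) auto
  qed
  then show ?thesis
    unfolding double_hits_def \<kappa>_def[symmetric] using m by blast
qed

lemma line_through_in_lines: "a \<noteq> b \<Longrightarrow> line_through a b \<in> lines"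
  unfolding line_through_def lines_def
  by (rule CollectI, rule exI[of _ a], rule exI[of _ "b - a"]) simp

lemma line_through_eq: "line_through a b = affine hull {a, b}"
  unfolding line_through_def affine_hull_2_alt by auto

lemma line_through_attains:
  obtains p where "p \<in> line_through a b" "infdist x (line_through a b) = dist x p"
  using infdist_attains_inf[of "line_through a b" x] that
  by (auto simp: line_through_eq closed_affine_hull)

text \<open>Points of the line \<open>ab\<close> near \<open>c\<close> and \<open>d\<close>,
  combined with the same affine weights that produce \<open>z\<close> from \<open>c\<close> and
  \<open>d\<close>, give a point of \<open>ab\<close>; the error grows linearly in the weight
  \<open>t\<close>, which is at most \<open>(dist x c + \<epsilon>) / dist c d\<close> in
  modulus.\<close>

lemma infdist_line_through_le:
  fixes a b c d x :: "real^'n"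
  assumes "infdist c (line_through a b) \<le> \<epsilon>" "infdist d (line_through a b) \<le> \<epsilon>"
    and "infdist x (line_through c d) \<le> \<epsilon>" and "0 < dist c d"
  shows "infdist x (line_through a b) \<le> \<epsilon> * (2 + 2 * ((dist x c + \<epsilon>) / dist c d))"
proof -
  obtain p where p: "p \<in> line_through a b" "dist c p \<le> \<epsilon>"
    using line_through_attains[of a b c] assms(1) by metis
  obtain q where q: "q \<in> line_through a b" "dist d q \<le> \<epsilon>"
    using line_through_attains[of a b d] assms(2) by metis
  obtain z where z: "z \<in> line_through c d" "dist x z \<le> \<epsilon>"
    using line_through_attains[of c d x] assms(3) by metis
  obtain t where t: "z = c + t *\<^sub>R (d - c)" using z(1) by (auto simp: line_through_def)
  have \<epsilon>0: "0 \<le> \<epsilon>" using z(2) zero_le_dist order_trans by blast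
  have "\<bar>t\<bar> * dist c d = dist z c" by (simp add: t dist_norm norm_minus_commute)
  also have "\<dots> \<le> dist x c + \<epsilon>" using z(2) dist_triangle[of z c x] by (simp add: dist_commute)
  finally have tle: "\<bar>t\<bar> \<le> (dist x c + \<epsilon>) / dist c d" using assms(4) by (simp add: field_simps)
  define u where "u = (1 - t) *\<^sub>R p + t *\<^sub>R q"
  have "u \<in> line_through a b"
    using p(1) q(1) unfolding u_def line_through_eq by (intro mem_affine affine_affine_hull) auto
  then have "infdist x (line_through a b) \<le> dist x u" by (rule infdist_le)
  also have "\<dots> \<le> dist x z + dist z u" by (rule dist_triangle)
  also have "z - u = (1 - t) *\<^sub>R (c - p) + t *\<^sub>R (d - q)" by (simp add: t u_def algebra_simps)
  then have "dist z u \<le> \<bar>1 - t\<bar> * dist c p + \<bar>t\<bar> * dist d q"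
    by (metis dist_norm norm_scaleR norm_triangle_ineq)
  also have "\<dots> \<le> (1 + \<bar>t\<bar>) * \<epsilon> + \<bar>t\<bar> * \<epsilon>"
    using p(2) q(2) \<epsilon>0 by (intro add_mono mult_mono) auto
  also have "dist x z + ((1 + \<bar>t\<bar>) * \<epsilon> + \<bar>t\<bar> * \<epsilon>) \<le> \<epsilon> * (2 + 2 * \<bar>t\<bar>)"
    using z(2) by (simp add: algebra_simps)
  also have "\<dots> \<le> \<epsilon> * (2 + 2 * ((dist x c + \<epsilon>) / dist c d))"
    using \<epsilon>0 tle by (intro mult_left_mono add_left_mono) simp_all
  finally show ?thesis by simp
qed

lemma dist_cball_ge:
  assumes "u \<in> cball p (r / 8)" "v \<in> cball q (r / 8)" "r / 2 \<le> dist p q"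
  shows "r / 4 \<le> dist u v"
  using assms dist_triangle[of p q u] dist_triangle[of u q v] by (simp add: dist_commute)

text \<open>Two reference arcs, starting at \<open>y\<close> and at some \<open>y\<^sub>2\<close> at distance \<open>r\<close> from \<open>y\<close>, and an arc starting at
  the point of \<open>\<Gamma>\<close> farthest from the line spanned by the first one. Some two of these three arcs are
  far apart and not aligned.\<close>
lemma flat_or_double_hits:
  fixes f :: "real \<Rightarrow> real^'n"
  assumes f: "continuous_on {0..1} f" and y: "y \<in> f ` {0..1}" and w: "w \<in> f ` {0..1}"
    and r: "0 < r" "r \<le> dist y w" and A: "1 \<le> A"
  obtains l \<eta> where "l \<in> lines" "0 \<le> \<eta>" "\<eta> \<le> A * r"
    "\<And>x. x \<in> f ` {0..1} \<Longrightarrow> dist y x \<le> A * r \<Longrightarrow> infdist x l \<le> \<eta>"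
    "0 < \<eta> \<Longrightarrow> double_hits (f ` {0..1}) y r ((A + 1) * r)
       ((1 / (16 * (A + 1))) ^ 4 / (432 * real CARD('n) ^ 4) / (2 * (A + 2)) * (\<eta> / (2 * (2 + 16 * (2 * A + 1)))))"
proof -
  let ?\<Gamma> = "f ` {0..1}"
  have r8: "0 \<le> r / 8" "0 \<le> r" and r8w: "r / 8 \<le> dist y w" using r by auto
  obtain P1 y' where P1: "P1 \<subseteq> ?\<Gamma>" "connected P1" "y \<in> P1" "y' \<in> P1" "dist y y' = r / 8" "P1 \<subseteq> cball y (r / 8)"
    using initial_arc[OF f y w r8(1) r8w] by metis
  obtain P0 y2 where y2: "P0 \<subseteq> ?\<Gamma>" "y2 \<in> P0" "dist y y2 = r"
    using initial_arc[OF f y w r8(2) r(2)] by metis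
  then have y2G: "y2 \<in> ?\<Gamma>" by blast
  have "r / 8 \<le> dist y2 y" using y2 r by (simp add: dist_commute)
  then obtain P2 y2' where P2: "P2 \<subseteq> ?\<Gamma>" "connected P2" "y2 \<in> P2" "y2' \<in> P2" "dist y2 y2' = r / 8" "P2 \<subseteq> cball y2 (r / 8)"
    using initial_arc[OF f y2G y r8(1)] by metis
  let ?l = "line_through y y'"
  have "compact (?\<Gamma> \<inter> cball y (A * r))"
    by (intro compact_Int_closed compact_continuous_image f) auto
  moreover have "y \<in> ?\<Gamma> \<inter> cball y (A * r)" using y r A by simp
  moreover have "continuous_on (?\<Gamma> \<inter> cball y (A * r)) (\<lambda>x. infdist x ?l)"
    by (intro continuous_intros)
  ultimately obtain c where c: "c \<in> ?\<Gamma> \<inter> cball y (A * r)"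
      "\<And>x. x \<in> ?\<Gamma> \<inter> cball y (A * r) \<Longrightarrow> infdist x ?l \<le> infdist c ?l"
    using continuous_attains_sup[of "?\<Gamma> \<inter> cball y (A * r)" "\<lambda>x. infdist x ?l"] by blast
  then have cG: "c \<in> ?\<Gamma>" and cA: "dist y c \<le> A * r" by auto
  \<comment> \<open>The point \<open>c\<close> cannot be close to both \<open>y\<close> and
    \<open>y2\<close>, so an arc of size \<open>r / 8\<close> can start at \<open>c\<close>
    too.\<close>
  have far: "\<exists>v\<in>?\<Gamma>. r / 8 \<le> dist c v"
  proof (rule ccontr)
    assume "\<not> ?thesis"
    then have "dist c y < r / 8" "dist c y2 < r / 8" using y y2G not_le by blast+
    then show False using dist_triangle3[of y y2 c] y2(3) r(1) by linarith
  qed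
  then obtain v where "v \<in> ?\<Gamma>" "r / 8 \<le> dist c v" by blast
  then obtain P3 c' where P3: "P3 \<subseteq> ?\<Gamma>" "connected P3" "c \<in> P3" "c' \<in> P3" "dist c c' = r / 8" "P3 \<subseteq> cball c (r / 8)"
    using initial_arc[OF f cG _ r8(1)] by metis
  define \<eta> where "\<eta> = infdist c ?l"
  \<comment> \<open>The factor in \<open>infdist_line_through_le\<close> for
    \<open>dist y2 y2' = r / 8\<close> and
    \<open>dist c y2 + \<delta> \<le> (2 * A + 1) * r\<close>.\<close>
  define K where "K = 2 + 16 * (2 * A + 1)"
  have K: "1 < K" using A by (simp add: K_def)
  have yl: "y \<in> ?l" unfolding line_through_eq by (simp add: hull_inc)
  have \<eta>: "0 \<le> \<eta>" "\<eta> \<le> A * r"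
    using infdist_le[OF yl, of c] cA by (auto simp: \<eta>_def infdist_nonneg dist_commute)
  have inball: "cball p (r / 8) \<subseteq> cball y ((A + 1) * r)" if "dist y p \<le> A * r" for p
  proof
    fix x assume "x \<in> cball p (r / 8)"
    then have "dist y x \<le> A * r + r / 8" using that dist_triangle[of y x p] by simp
    also have "\<dots> \<le> (A + 1) * r" using r by (simp add: algebra_simps)
    finally show "x \<in> cball y ((A + 1) * r)" by simp
  qed
  have Ar: "0 \<le> A * r" "r \<le> A * r" using A r by auto
  have Q1: "P1 \<subseteq> ?\<Gamma> \<inter> cball y ((A + 1) * r)" using P1 inball[of y] Ar by auto
  have Q2: "P2 \<subseteq> ?\<Gamma> \<inter> cball y ((A + 1) * r)" using P2 inball[of y2] y2(3) Ar by auto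
  have Q3: "P3 \<subseteq> ?\<Gamma> \<inter> cball y ((A + 1) * r)" using P3 inball[of c] cA by auto
  have hits: "double_hits ?\<Gamma> y r ((A + 1) * r)
      ((1 / (16 * (A + 1))) ^ 4 / (432 * real CARD('n) ^ 4) / (2 * (A + 2)) * (\<eta> / (2 * K)))"
    if pos: "0 < \<eta>"
  proof -
    define \<delta> where "\<delta> = \<eta> / (2 * K)"
    have \<delta>: "0 < \<delta>" "\<delta> \<le> \<eta>" using pos K by (auto simp: \<delta>_def field_simps)
    \<comment> \<open>If \<open>c\<close> is close to \<open>y\<close>, it is far from
      \<open>y2\<close>. Were \<open>c\<close> then near the line through \<open>y2\<close> and
      \<open>y2'\<close>, and both of these near \<open>?l\<close>, then \<open>c\<close> would be
      within \<open>\<eta> / 2\<close> of \<open>?l\<close>, against the definition of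
      \<open>\<eta>\<close>.\<close>
    consider (far) "r / 2 \<le> dist y c" | (line2) "r / 2 \<le> dist y2 c" "\<delta> \<le> infdist c (line_through y2 y2')"
      | (ref) "\<delta> \<le> infdist y2 ?l \<or> \<delta> \<le> infdist y2' ?l"
    proof -
      have False if n: "infdist c (line_through y2 y2') < \<delta>" "infdist y2 ?l < \<delta>" "infdist y2' ?l < \<delta>"
      proof -
        have "\<eta> \<le> \<delta> * (2 + 2 * ((dist c y2 + \<delta>) / (r / 8)))"
          using infdist_line_through_le[of y2 y y' \<delta> y2' c] n P2(5) r(1) by (simp add: \<eta>_def)
        also have "\<dots> \<le> \<delta> * K"
        proof -
          have "dist c y2 + \<delta> \<le> (A * r + r) + A * r"
            using dist_triangle3[of c y2 y] cA y2(3) \<delta> \<eta> by linarith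
          then have "(dist c y2 + \<delta>) / (r / 8) \<le> ((A * r + r) + A * r) / (r / 8)"
            using r by (intro divide_right_mono) auto
          also have "\<dots> = 8 * (2 * A + 1)" using r by (simp add: field_simps)
          finally have "2 + 2 * ((dist c y2 + \<delta>) / (r / 8)) \<le> K" unfolding K_def by linarith
          then show ?thesis using \<delta> by (intro mult_left_mono) auto
        qed
        also have "\<dots> = \<eta> / 2" using K by (simp add: \<delta>_def)
        finally show False using pos by simp
      qed
      moreover have "r / 2 \<le> dist y c \<or> r / 2 \<le> dist y2 c"
        using dist_triangle2[of y y2 c] y2(3) by linarith
      ultimately show ?thesis using that by (meson not_le)
    qed
    then have "double_hits ?\<Gamma> y r ((A + 1) * r)
        ((1 / (16 * (A + 1))) ^ 4 / (432 * real CARD('n) ^ 4) / (2 * (A + 2)) * \<delta>)"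
    proof cases
      case far
      show ?thesis
      proof (rule double_hits_of_arcs[OF r(1) A Q1 P1(2-5) Q3 P3(2-5) _ \<delta>(1)])
        show "r / 4 \<le> dist s s'" if "s \<in> P1" "s' \<in> P3" for s s'
          using that dist_cball_ge[of s y r s' c] P1(6) P3(6) far by blast
      qed (use \<delta>(2) in \<open>simp add: \<eta>_def\<close>)
    next
      case line2
      show ?thesis
      proof (rule double_hits_of_arcs[OF r(1) A Q2 P2(2-5) Q3 P3(2-5) _ \<delta>(1)])
        show "r / 4 \<le> dist s s'" if "s \<in> P2" "s' \<in> P3" for s s'
          using that dist_cball_ge[of s y2 r s' c] P2(6) P3(6) line2 by blast
      qed (use line2 in simp)
    next
      case ref
      have far: "r / 2 \<le> dist y y2" using y2(3) r by simp
      show ?thesis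
      proof (rule double_hits_of_arcs[OF r(1) A Q1 P1(2-5) Q2 P2(2-5) _ \<delta>(1)])
        show "r / 4 \<le> dist s s'" if "s \<in> P1" "s' \<in> P2" for s s'
          using that dist_cball_ge[of s y r s' y2] P1(6) P2(6) far by blast
      qed (use ref in simp)
    qed
    then show ?thesis unfolding \<delta>_def .
  qed
  show ?thesis
  proof (rule that[of ?l \<eta>])
    show "?l \<in> lines" using P1(5) r by (intro line_through_in_lines) auto
  qed (use \<eta> c(2) hits in \<open>auto simp: \<eta>_def K_def\<close>)
qed

section \<open>Counting dyadic cubes near a point or a bounded set\<close>

lemma cubes_near:
  fixes x :: "real^'n" and R :: real
  assumes "0 \<le> R"
  shows "finite {j. dist (dcenter k j) x \<le> R * side k}" (is "finite ?J")
    and "card {j. dist (dcenter k j) x \<le> R * side k} \<le> (nat \<lfloor>2 * R\<rfloor> + 2) ^ CARD('n)"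
proof -
  define B where "B i = {\<lceil>x $ i / side k - 1 / 2 - R\<rceil>..\<lfloor>x $ i / side k - 1 / 2 + R\<rfloor>}" for i
  have sub: "?J \<subseteq> PiE UNIV B"
  proof
    fix j assume j: "j \<in> ?J"
    have "j i \<in> B i" for i
    proof -
      have "\<bar>(dcenter k j - x) $ i\<bar> \<le> R * side k"
        using j component_le_norm_cart[of "dcenter k j - x" i] by (auto simp: dist_norm intro: order_trans)
      then have "\<bar>(real_of_int (j i) + 1 / 2 - x $ i / side k) * side k\<bar> \<le> R * side k"
        by (simp add: dcenter_def algebra_simps less_imp_neq[THEN not_sym])
      then have "\<bar>real_of_int (j i) + 1 / 2 - x $ i / side k\<bar> \<le> R"
        by (simp add: abs_mult abs_of_pos)
      then show ?thesis unfolding B_def by (simp add: ceiling_le_iff le_floor_iff abs_le_iff)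
    qed
    then show "j \<in> PiE UNIV B" by (simp add: PiE_UNIV_domain)
  qed
  have fin: "finite (PiE UNIV B)" by (rule finite_PiE) (auto simp: B_def)
  show "finite ?J" by (rule finite_subset[OF sub fin])
  have "card (B i) \<le> nat \<lfloor>2 * R\<rfloor> + 2" for i
    unfolding B_def card_atLeastAtMost_int using assms by linarith
  then have "(\<Prod>i\<in>UNIV. card (B i)) \<le> (\<Prod>i\<in>(UNIV :: 'n set). nat \<lfloor>2 * R\<rfloor> + 2)"
    by (intro prod_mono) auto
  then have "card (PiE UNIV B) \<le> (nat \<lfloor>2 * R\<rfloor> + 2) ^ CARD('n)" by (simp add: card_PiE)
  then show "card ?J \<le> (nat \<lfloor>2 * R\<rfloor> + 2) ^ CARD('n)" using card_mono[OF fin sub] by linarith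
qed

lemma dist_dcenter_le:
  fixes x :: "real^'n"
  assumes "x \<in> dcube k j"
  shows "dist (dcenter k j) x \<le> real CARD('n) * side k"
proof -
  have "\<bar>(dcenter k j - x) $ i\<bar> \<le> side k" for i
  proof -
    have "real_of_int (j i) * side k \<le> x $ i" "x $ i < real_of_int (j i) * side k + side k"
      using assms by (auto simp: dcube_def algebra_simps)
    then show ?thesis using side_pos[of k] by (simp add: dcenter_def algebra_simps abs_le_iff)
  qed
  then have "(\<Sum>i\<in>UNIV. \<bar>(dcenter k j - x) $ i\<bar>) \<le> (\<Sum>i\<in>(UNIV :: 'n set). side k)"
    by (intro sum_mono)
  then show ?thesis using norm_le_l1_cart[of "dcenter k j - x"] by (simp add: dist_norm)
qed

lemma finite_cubes:
  fixes B :: "(real^'n) set"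
  assumes B: "bounded B" and r: "0 < r"
  shows "finite {p. 0 \<le> fst p \<and> r \<le> side (fst p) \<and> B \<inter> dcube (fst p) (snd p) \<noteq> {}}"
    (is "finite ?Q")
proof -
  obtain R where R: "\<And>x. x \<in> B \<Longrightarrow> norm x \<le> R" "0 < R" using B by (auto simp: bounded_pos)
  obtain K where K: "(1 / 2) ^ K < r" using real_arch_pow_inv[of r "1 / 2"] r by auto
  define J where "J k = {j :: 'n \<Rightarrow> int. dist (dcenter k j) 0 \<le> (R / side k + real CARD('n)) * side k}" for k
  have "?Q \<subseteq> (\<Union>k\<in>{0..int K}. Pair k ` J k)"
  proof
    fix p assume p: "p \<in> ?Q"
    then obtain x where x: "x \<in> B" "x \<in> dcube (fst p) (snd p)" by blast
    have k: "fst p = int (nat (fst p))" using p by simp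
    have "nat (fst p) < K"
    proof (rule ccontr)
      assume "\<not> nat (fst p) < K"
      then have "(1 / 2 :: real) ^ nat (fst p) \<le> (1 / 2) ^ K" by (intro power_decreasing) auto
      moreover have "r \<le> (1 / 2) ^ nat (fst p)" using p k side_nat[of "nat (fst p)"] by simp
      ultimately show False using K by linarith
    qed
    moreover have "dist (dcenter (fst p) (snd p)) 0 \<le> R + real CARD('n) * side (fst p)"
      using dist_triangle[of "dcenter (fst p) (snd p)" 0 x] dist_dcenter_le[OF x(2)] R(1)[OF x(1)] by simp
    then have "snd p \<in> J (fst p)" by (simp add: J_def distrib_right less_imp_neq[THEN not_sym])
    ultimately show "p \<in> (\<Union>k\<in>{0..int K}. Pair k ` J k)" using p by (intro UN_I[of "fst p"] image_eqI[of _ _ "snd p"]) auto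
  qed
  moreover have "finite (\<Union>k\<in>{0..int K}. Pair k ` J k)"
    unfolding J_def using R(2) by (intro finite_UN_I finite_imageI cubes_near(1)) (auto simp: less_imp_le)
  ultimately show ?thesis by (rule finite_subset)
qed

text \<open>Each cube owns a strip of area \<open>4 * \<delta>\<^sup>2 / side\<close>. By
  \<open>count_cubes\<close>, the strips of one coordinate pair that contain a given
  \<open>(m, q)\<close> number at most \<open>C0\<close> times the curve points chosen on that
  hyperplane; integration over the parameter plane bounds the total area.\<close>

lemma double_hits_sum:
  fixes f :: "real \<Rightarrow> real^'n"
  assumes f: "L-lipschitz_on {0..1} f" and \<rho>: "0 \<le> \<rho>"
  obtains C where "\<And>F y \<delta>. finite F \<Longrightarrow>
    (\<And>k j. (k, j) \<in> F \<Longrightarrow> 0 \<le> k \<and> y (k, j) \<in> dcube k j \<and> 0 \<le> \<delta> (k, j) \<and> \<delta> (k, j) \<le> side k \<and>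
       double_hits (f ` {0..1}) (y (k, j)) (side k) (\<rho> * side k) (\<delta> (k, j))) \<Longrightarrow>
    (\<Sum>p\<in>F. (\<delta> p)\<^sup>2 / side (fst p)) \<le> C"
proof -
  obtain C0 :: nat where C0: "\<And>(S :: (real^'n) set) F. finite S \<Longrightarrow> finite F \<Longrightarrow>
     (\<And>k j. (k, j) \<in> F \<Longrightarrow> 0 \<le> k \<and> (\<exists>s\<in>S. \<exists>s'\<in>S. dist (dcenter k j) s \<le> (\<rho> + real CARD('n)) * side k \<and>
         dist (dcenter k j) s' \<le> (\<rho> + real CARD('n)) * side k \<and> side k / 4 \<le> dist s s')) \<Longrightarrow>
     card F \<le> C0 * card S"
    using count_cubes[of "\<rho> + real CARD('n)"] \<rho> by auto
  have L: "0 \<le> L" using lipschitz_on_nonneg[OF f] .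
  define n where "n = real CARD('n \<times> 'n)"
  have "(\<Sum>p\<in>F. (\<delta> p)\<^sup>2 / side (fst p)) \<le> n * (real C0 * (48 * L)) / 4"
    if F: "finite F" and H: "\<And>k j. (k, j) \<in> F \<Longrightarrow> 0 \<le> k \<and> y (k, j) \<in> dcube k j \<and> 0 \<le> \<delta> (k, j) \<and> \<delta> (k, j) \<le> side k \<and>
       double_hits (f ` {0..1}) (y (k, j)) (side k) (\<rho> * side k) (\<delta> (k, j))"
    for F and y :: "int \<times> ('n \<Rightarrow> int) \<Rightarrow> real^'n" and \<delta>
  proof -
    have H1: "0 \<le> fst p" "y p \<in> dcube (fst p) (snd p)" "0 \<le> \<delta> p" "\<delta> p \<le> side (fst p)"
      "double_hits (f ` {0..1}) (y p) (side (fst p)) (\<rho> * side (fst p)) (\<delta> p)" if "p \<in> F" for p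
      using H[of "fst p" "snd p"] that by auto
    define good where "good p ij m z q \<longleftrightarrow> \<bar>m\<bar> \<le> 1 \<and> (\<forall>m' q'. (m', q') \<in> strip m (\<delta> p / side (fst p)) z q (\<delta> p) \<longrightarrow>
     (\<exists>s\<in>f ` {0..1}. \<exists>s'\<in>f ` {0..1}. dist (y p) s \<le> \<rho> * side (fst p) \<and> dist (y p) s' \<le> \<rho> * side (fst p) \<and>
        side (fst p) / 4 \<le> dist s s' \<and>
        s $ fst ij - m' * s $ snd ij = q' \<and> s' $ fst ij - m' * s' $ snd ij = q'))"
      for p :: "int \<times> ('n \<Rightarrow> int)" and ij :: "'n \<times> 'n" and m z q
    have "\<exists>ij m z q. good p ij m z q" if p: "p \<in> F" for p
    proof -
      obtain i j m z q where "good p (i, j) m z q"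
        using H1(5)[OF p] unfolding double_hits_def good_def fst_conv snd_conv by blast
      then show ?thesis by blast
    qed
    then obtain ij m z q where good: "\<And>p. p \<in> F \<Longrightarrow> good p (ij p) (m p) (z p) (q p)"
      by metis
    have m: "\<bar>m p\<bar> \<le> 1" if "p \<in> F" for p using good[OF that] by (simp add: good_def)
    have hit: "\<exists>s\<in>f ` {0..1}. \<exists>s'\<in>f ` {0..1}. dist (y p) s \<le> \<rho> * side (fst p) \<and> dist (y p) s' \<le> \<rho> * side (fst p) \<and>
        side (fst p) / 4 \<le> dist s s' \<and>
        s $ fst (ij p) - m' * s $ snd (ij p) = q' \<and> s' $ fst (ij p) - m' * s' $ snd (ij p) = q'"
      if "p \<in> F" "(m', q') \<in> strip (m p) (\<delta> p / side (fst p)) (z p) (q p) (\<delta> p)" for p m' q'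
      using good[OF that(1)] that(2) unfolding good_def by blast
    define A where "A p = strip (m p) (\<delta> p / side (fst p)) (z p) (q p) (\<delta> p)" for p
    \<comment> \<open>The coordinate pairs are treated separately, because only for a common pair
      does \<open>(m', q')\<close> denote the same hyperplane for all cubes.\<close>
    have point: "(\<Sum>p\<in>{p \<in> F. ij p = e}. indicator (A p) x) \<le> of_nat C0 * liminf (\<lambda>k. incidence f L (fst e) (snd e) k x)"
      for e x
    proof -
      obtain m' q' where x: "x = (m', q')" by force
      define G where "G = {p \<in> F. ij p = e \<and> x \<in> A p}"
      define near where "near p s \<longleftrightarrow> s \<in> f ` {0..1} \<and> dist (y p) s \<le> \<rho> * side (fst p) \<and> s $ fst e - m' * s $ snd e = q'"
        for p s
      have "\<exists>s s'. near p s \<and> near p s' \<and> side (fst p) / 4 \<le> dist s s'" if "p \<in> G" for p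
      proof -
        have "p \<in> F" "ij p = e" "(m', q') \<in> strip (m p) (\<delta> p / side (fst p)) (z p) (q p) (\<delta> p)"
          using that by (auto simp: G_def A_def x)
        then show ?thesis using hit[of p m' q'] unfolding near_def by blast
      qed
      then obtain s s' where near: "\<And>p. p \<in> G \<Longrightarrow> near p (s p)" "\<And>p. p \<in> G \<Longrightarrow> near p (s' p)"
        "\<And>p. p \<in> G \<Longrightarrow> side (fst p) / 4 \<le> dist (s p) (s' p)"
        by metis
      have ss: "s p \<in> f ` {0..1}" "s' p \<in> f ` {0..1}"
        "dist (y p) (s p) \<le> \<rho> * side (fst p)" "dist (y p) (s' p) \<le> \<rho> * side (fst p)"
        "side (fst p) / 4 \<le> dist (s p) (s' p)"
        "s p $ fst e - m' * s p $ snd e = q'" "s' p $ fst e - m' * s' p $ snd e = q'" if "p \<in> G" for p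
        using near[OF that] by (auto simp: near_def)
      define S where "S = s ` G \<union> s' ` G"
      have finG: "finite G" using F by (simp add: G_def)
      have card: "card G \<le> C0 * card S"
      proof (rule C0)
        fix k j assume p: "(k, j) \<in> G"
        have pF: "(k, j) \<in> F" using p by (simp add: G_def)
        have "dist (dcenter k j) v \<le> (\<rho> + real CARD('n)) * side k" if "dist (y (k, j)) v \<le> \<rho> * side k" for v
          using dist_triangle[of "dcenter k j" v "y (k, j)"] dist_dcenter_le[of "y (k, j)" k j] H1(2)[OF pF] that
          by (simp add: algebra_simps)
        then show "0 \<le> k \<and> (\<exists>s\<in>S. \<exists>s'\<in>S. dist (dcenter k j) s \<le> (\<rho> + real CARD('n)) * side k \<and>
         dist (dcenter k j) s' \<le> (\<rho> + real CARD('n)) * side k \<and> side k / 4 \<le> dist s s')"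
          using ss(3-5)[OF p] H1(1)[OF pF] p by (auto simp: S_def)
      qed (auto simp: S_def finG)
      have "of_nat (card S) \<le> liminf (\<lambda>k. incidence f L (fst e) (snd e) k x)" if ne: "G \<noteq> {}"
      proof -
        obtain p where p: "p \<in> F" "x \<in> A p" using ne unfolding G_def by blast
        \<comment> \<open>The bound of \<open>\<delta>\<close> by the side keeps the tilted slope
          within 2, the range covered by \<open>incidence\<close>.\<close>
        have "\<bar>m' - m p\<bar> \<le> \<delta> p / side (fst p)" using p(2) by (simp add: A_def strip_def x)
        moreover have "\<delta> p / side (fst p) \<le> 1" using H1(4)[OF p(1)] by simp
        ultimately have "\<bar>m'\<bar> \<le> 2" using m[OF p(1)] by linarith
        then show ?thesis
          unfolding x using ss finG by (intro card_le_liminf_incidence[OF f]) (auto simp: S_def)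
      qed
      then have "of_nat (card G) \<le> of_nat C0 * liminf (\<lambda>k. incidence f L (fst e) (snd e) k x)"
      proof (cases "G = {}")
        case False
        have "(of_nat (card G) :: ennreal) \<le> of_nat (C0 * card S)" using card by (rule of_nat_mono)
        also have "\<dots> \<le> of_nat C0 * liminf (\<lambda>k. incidence f L (fst e) (snd e) k x)"
          using \<open>G \<noteq> {} \<Longrightarrow> _\<close>[OF False] by (simp add: mult_left_mono)
        finally show ?thesis .
      qed simp
      moreover have "(\<Sum>p\<in>{p \<in> F. ij p = e}. indicator (A p) x) = (of_nat (card G) :: ennreal)"
      proof -
        have "(\<Sum>p\<in>{p \<in> F. ij p = e}. indicator (A p) x) = (\<Sum>p\<in>{p \<in> F. ij p = e}. if x \<in> A p then 1 else 0 :: ennreal)"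
          by (intro sum.cong refl) (simp add: indicator_def)
        also have "\<dots> = (\<Sum>p\<in>{p \<in> {p \<in> F. ij p = e}. x \<in> A p}. 1)"
          using F by (intro sum.inter_filter[symmetric]) simp
        also have "{p \<in> {p \<in> F. ij p = e}. x \<in> A p} = G" by (auto simp: G_def)
        finally show ?thesis by simp
      qed
      ultimately show ?thesis by simp
    qed
    have "ennreal (\<Sum>p\<in>F. 4 * (\<delta> p / side (fst p)) * \<delta> p) = (\<Sum>p\<in>F. ennreal (4 * (\<delta> p / side (fst p)) * \<delta> p))"
      using H1(3) by (intro sum_ennreal[symmetric]) (auto simp: less_imp_le)
    also have "\<dots> = (\<Sum>p\<in>F. emeasure lborel (A p))"
      unfolding A_def using H1(3) by (intro sum.cong refl emeasure_strip[symmetric]) (auto simp: less_imp_le)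
    also have "\<dots> = (\<Sum>e\<in>UNIV. \<Sum>p\<in>{p \<in> F. ij p = e}. emeasure lborel (A p))"
      using F by (intro sum.group[symmetric]) auto
    also have "\<dots> = (\<Sum>e\<in>UNIV. \<integral>\<^sup>+ x. (\<Sum>p\<in>{p \<in> F. ij p = e}. indicator (A p) x) \<partial>lborel)"
      by (subst nn_integral_sum) (auto simp: A_def)
    also have "\<dots> \<le> (\<Sum>e\<in>(UNIV :: ('n \<times> 'n) set). ennreal (real C0 * (48 * L)))"
    proof (rule sum_mono)
      fix e :: "'n \<times> 'n"
      have "(\<integral>\<^sup>+ x. (\<Sum>p\<in>{p \<in> F. ij p = e}. indicator (A p) x) \<partial>lborel)
          \<le> (\<integral>\<^sup>+ x. of_nat C0 * liminf (\<lambda>k. incidence f L (fst e) (snd e) k x) \<partial>lborel)"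
        by (intro nn_integral_mono point)
      also have "\<dots> = of_nat C0 * (\<integral>\<^sup>+ x. liminf (\<lambda>k. incidence f L (fst e) (snd e) k x) \<partial>lborel)"
        by (rule nn_integral_cmult) simp
      also have "\<dots> \<le> of_nat C0 * ennreal (48 * L)"
        by (intro mult_left_mono nn_integral_liminf_incidence L) simp
      also have "\<dots> = ennreal (real C0 * (48 * L))"
        using L by (simp add: ennreal_mult ennreal_of_nat_eq_real_of_nat)
      finally show "(\<integral>\<^sup>+ x. (\<Sum>p\<in>{p \<in> F. ij p = e}. indicator (A p) x) \<partial>lborel) \<le> ennreal (real C0 * (48 * L))" .
    qed
    also have "\<dots> = ennreal (\<Sum>e\<in>(UNIV :: ('n \<times> 'n) set). real C0 * (48 * L))"
      using L by (intro sum_ennreal) auto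
    also have "\<dots> = ennreal (n * (real C0 * (48 * L)))" by (simp add: n_def)
    finally have "(\<Sum>p\<in>F. 4 * (\<delta> p / side (fst p)) * \<delta> p) \<le> n * (real C0 * (48 * L))"
      using L by (subst (asm) ennreal_le_iff) (auto simp: n_def)
    moreover have "(\<Sum>p\<in>F. 4 * (\<delta> p / side (fst p)) * \<delta> p) = 4 * (\<Sum>p\<in>F. (\<delta> p)\<^sup>2 / side (fst p))"
      by (simp add: sum_distrib_left power2_eq_square mult.assoc)
    ultimately show ?thesis by linarith
  qed
  then show ?thesis using that by blast
qed

section \<open>From double hits to the flatness of the curve\<close>

definition flat_data :: "(real^'n) set \<Rightarrow> real \<Rightarrow> int \<times> ('n::finite \<Rightarrow> int) \<Rightarrow> real^'n \<Rightarrow> (real^'n) set \<Rightarrow> real \<Rightarrow> bool" where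
  "flat_data \<Gamma> A p y l \<eta> \<longleftrightarrow> y \<in> \<Gamma> \<inter> dcube (fst p) (snd p) \<and> l \<in> lines \<and> 0 \<le> \<eta> \<and>
     (\<forall>x\<in>\<Gamma>. dist y x \<le> A * side (fst p) \<longrightarrow> infdist x l \<le> \<eta>)"

lemma obtain_line:
  fixes y :: "real^'n"
  obtains l where "l \<in> lines" "y \<in> l"
proof
  show "line_through y (y + axis undefined 1) \<in> lines"
    by (intro line_through_in_lines) simp
  show "y \<in> line_through y (y + axis undefined 1)"
    by (simp add: line_through_eq hull_inc)
qed

text \<open>\<open>flat_or_double_hits\<close> needs a curve point at distance at least the side.
  Cubes too large for this are finite in number and only add a constant, and a curve reduced to a
  point has \<open>\<eta> = 0\<close>. All other cubes are summed by \<open>double_hits_sum\<close>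
  after rescaling \<open>\<eta>\<close> by \<open>c\<close>.\<close>

lemma traveling_salesman_necessity:
  fixes f :: "real \<Rightarrow> real^'n" and A :: real
  assumes f: "L-lipschitz_on {0..1} f" and A: "1 \<le> A"
  defines "\<Gamma> \<equiv> f ` {0..1}"
  obtains y l \<eta> C where
    "\<And>p. 0 \<le> fst p \<Longrightarrow> \<Gamma> \<inter> dcube (fst p) (snd p) \<noteq> {} \<Longrightarrow> flat_data \<Gamma> A p (y p) (l p) (\<eta> p)"
    "\<And>F. finite F \<Longrightarrow> \<forall>p\<in>F. 0 \<le> fst p \<and> \<Gamma> \<inter> dcube (fst p) (snd p) \<noteq> {} \<Longrightarrow>
      (\<Sum>p\<in>F. (\<eta> p)\<^sup>2 / side (fst p)) \<le> C"
proof -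
  \<comment> \<open>The first entry is the constant of \<open>flat_or_double_hits\<close>; the
    second gives \<open>c * \<eta> \<le> side\<close>, as \<open>double_hits_sum\<close>
    requires.\<close>
  define c where "c = min ((1 / (16 * (A + 1))) ^ 4 / (432 * real CARD('n) ^ 4) / (2 * (A + 2)) / (2 * (2 + 16 * (2 * A + 1)))) (1 / A)"
  have c: "0 < c" "c * A \<le> 1"
  proof -
    show "0 < c" using A by (auto simp: c_def)
    have "c * A \<le> 1 / A * A" using A by (intro mult_right_mono) (auto simp: c_def)
    then show "c * A \<le> 1" using A by simp
  qed
  have cont: "continuous_on {0..1} f" using f by (rule lipschitz_on_continuous_on)
  \<comment> \<open>Half the distance of two distinct curve points serves, since no point is closer
    than that to both.\<close>
  obtain r0 where r0: "0 < r0" "\<And>y. y \<in> \<Gamma> \<Longrightarrow> (\<forall>x\<in>\<Gamma>. x = y) \<or> (\<exists>w\<in>\<Gamma>. r0 \<le> dist y w)"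
  proof (cases "\<exists>u\<in>\<Gamma>. \<exists>v\<in>\<Gamma>. u \<noteq> v")
    case True
    then obtain u v where uv: "u \<in> \<Gamma>" "v \<in> \<Gamma>" "u \<noteq> v" by blast
    show ?thesis
    proof (rule that[of "dist u v / 2"])
      fix y assume "y \<in> \<Gamma>"
      have "dist u v / 2 \<le> dist y u \<or> dist u v / 2 \<le> dist y v"
        using dist_triangle3[of u v y] by linarith
      then show "(\<forall>x\<in>\<Gamma>. x = y) \<or> (\<exists>w\<in>\<Gamma>. dist u v / 2 \<le> dist y w)" using uv by blast
    qed (use uv in simp)
  next
    case False
    then show ?thesis by (intro that[of 1]) auto
  qed
  define Q where "Q = {p :: int \<times> ('n \<Rightarrow> int). 0 \<le> fst p \<and> \<Gamma> \<inter> dcube (fst p) (snd p) \<noteq> {}}"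
  define good where "good p y l \<eta> \<longleftrightarrow> flat_data \<Gamma> A p y l \<eta> \<and>
      (\<eta> = 0 \<or> r0 < side (fst p) \<or> c * \<eta> \<le> side (fst p) \<and> double_hits \<Gamma> y (side (fst p)) ((A + 1) * side (fst p)) (c * \<eta>))"
    for p y l \<eta>
  have "\<exists>y l \<eta>. good p y l \<eta>"
    if p: "p \<in> Q" for p
  proof -
    obtain y where y: "y \<in> \<Gamma>" "y \<in> dcube (fst p) (snd p)" using p by (auto simp: Q_def)
    obtain l where l: "l \<in> lines" "y \<in> l" by (rule obtain_line)
    have s: "0 < side (fst p)" by simp
    consider "\<forall>x\<in>\<Gamma>. x = y" | "r0 < side (fst p)" | w where "w \<in> \<Gamma>" "r0 \<le> dist y w" "side (fst p) \<le> r0"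
      using r0(2)[OF y(1)] by (meson not_le)
    then show ?thesis
    proof cases
      case 1
      have "infdist y l = 0" using l(2) by simp
      then have "\<forall>x\<in>\<Gamma>. infdist x l \<le> 0" using 1 by (metis order_refl)
      then have "flat_data \<Gamma> A p y l 0" using y l by (simp add: flat_data_def)
      then show ?thesis by (auto simp: good_def)
    next
      \<comment> \<open>Any line through \<open>y\<close> serves, with the trivial bound
        \<open>A * side\<close>.\<close>
      case 2
      have "infdist x l \<le> A * side (fst p)" if "dist y x \<le> A * side (fst p)" for x
        using infdist_le[OF l(2), of x] that by (simp add: dist_commute)
      then have "flat_data \<Gamma> A p y l (A * side (fst p))"
        using y l A s by (auto simp: flat_data_def less_imp_le intro!: mult_nonneg_nonneg)
      then show ?thesis using 2 by (auto simp: good_def)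
    next
      case 3
      obtain l \<eta> where *: "l \<in> lines" "0 \<le> \<eta>" "\<eta> \<le> A * side (fst p)"
        "\<And>x. x \<in> \<Gamma> \<Longrightarrow> dist y x \<le> A * side (fst p) \<Longrightarrow> infdist x l \<le> \<eta>"
        "0 < \<eta> \<Longrightarrow> double_hits \<Gamma> y (side (fst p)) ((A + 1) * side (fst p))
           ((1 / (16 * (A + 1))) ^ 4 / (432 * real CARD('n) ^ 4) / (2 * (A + 2)) * (\<eta> / (2 * (2 + 16 * (2 * A + 1)))))"
        by (rule flat_or_double_hits[OF cont y(1)[unfolded \<Gamma>_def] 3(1)[unfolded \<Gamma>_def] s order_trans[OF 3(3,2)] A,
              folded \<Gamma>_def]) (rule that; blast)
      have "flat_data \<Gamma> A p y l \<eta>" using y * by (auto simp: flat_data_def)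
      moreover have "c * \<eta> \<le> side (fst p)"
      proof -
        have "c * \<eta> \<le> c * (A * side (fst p))" using c * by (intro mult_left_mono) auto
        also have "\<dots> \<le> 1 * side (fst p)" unfolding mult.assoc[symmetric] using c s by (intro mult_right_mono) auto
        finally show ?thesis by simp
      qed
      moreover have "double_hits \<Gamma> y (side (fst p)) ((A + 1) * side (fst p)) (c * \<eta>)" if "\<eta> \<noteq> 0"
      proof (rule double_hits_mono[OF *(5) _ s])
        have "c * \<eta> \<le> (1 / (16 * (A + 1))) ^ 4 / (432 * real CARD('n) ^ 4) / (2 * (A + 2)) / (2 * (2 + 16 * (2 * A + 1))) * \<eta>"
          using *(2) by (intro mult_right_mono) (simp_all add: c_def)
        then show "c * \<eta> \<le> (1 / (16 * (A + 1))) ^ 4 / (432 * real CARD('n) ^ 4) / (2 * (A + 2)) * (\<eta> / (2 * (2 + 16 * (2 * A + 1))))"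
          by simp
      qed (use that *(2) in simp)
      ultimately have "good p y l \<eta>" unfolding good_def by blast
      then show ?thesis by blast
    qed
  qed
  then obtain y l \<eta> where good: "\<And>p. p \<in> Q \<Longrightarrow> good p (y p) (l p) (\<eta> p)" by metis
  have data: "flat_data \<Gamma> A p (y p) (l p) (\<eta> p)" if "p \<in> Q" for p
    using good[OF that] by (simp add: good_def)
  have alt: "\<eta> p = 0 \<or> r0 < side (fst p) \<or>
      c * \<eta> p \<le> side (fst p) \<and> double_hits \<Gamma> (y p) (side (fst p)) ((A + 1) * side (fst p)) (c * \<eta> p)" if "p \<in> Q" for p
    using good[OF that] by (simp add: good_def)
  obtain C where C: "\<And>F y \<delta>. finite F \<Longrightarrow>
    (\<And>k j. (k, j) \<in> F \<Longrightarrow> 0 \<le> k \<and> y (k, j) \<in> dcube k j \<and> 0 \<le> \<delta> (k, j) \<and> \<delta> (k, j) \<le> side k \<and>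
       double_hits (f ` {0..1}) (y (k, j)) (side k) ((A + 1) * side k) (\<delta> (k, j))) \<Longrightarrow>
    (\<Sum>p\<in>F. (\<delta> p)\<^sup>2 / side (fst p)) \<le> C"
    using double_hits_sum[OF f, of "A + 1"] A by auto
  define QL where "QL = {p \<in> Q. r0 < side (fst p)}"
  have "bounded \<Gamma>"
    unfolding \<Gamma>_def by (intro compact_imp_bounded compact_continuous_image cont) simp
  then have finQL: "finite QL"
    by (rule finite_subset[rotated, OF finite_cubes[OF _ r0(1)]]) (auto simp: QL_def Q_def)
  have bound: "(\<Sum>p\<in>F. (\<eta> p)\<^sup>2 / side (fst p)) \<le> C / c\<^sup>2 + (\<Sum>p\<in>QL. (\<eta> p)\<^sup>2 / side (fst p))"
    if F: "finite F" "F \<subseteq> Q" for F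
  proof -
    define G where "G = {p \<in> F. \<eta> p \<noteq> 0 \<and> p \<notin> QL}"
    have "(\<Sum>p\<in>F. (\<eta> p)\<^sup>2 / side (fst p)) = (\<Sum>p\<in>{p \<in> F. \<eta> p \<noteq> 0}. (\<eta> p)\<^sup>2 / side (fst p))"
      using F by (intro sum.mono_neutral_right) auto
    also have "\<dots> \<le> (\<Sum>p\<in>G \<union> QL. (\<eta> p)\<^sup>2 / side (fst p))"
      using F finQL by (intro sum_mono2) (auto simp: G_def less_imp_le)
    also have "\<dots> = (\<Sum>p\<in>G. (\<eta> p)\<^sup>2 / side (fst p)) + (\<Sum>p\<in>QL. (\<eta> p)\<^sup>2 / side (fst p))"
      using F finQL by (intro sum.union_disjoint) (auto simp: G_def)
    also have "(\<Sum>p\<in>G. (\<eta> p)\<^sup>2 / side (fst p)) = (\<Sum>p\<in>G. (c * \<eta> p)\<^sup>2 / side (fst p)) / c\<^sup>2"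
      using c by (simp add: sum_divide_distrib power_mult_distrib)
    also have "(\<Sum>p\<in>G. (c * \<eta> p)\<^sup>2 / side (fst p)) \<le> C"
    proof (rule C[where y = y])
      fix k j assume p: "(k, j) \<in> G"
      then have pQ: "(k, j) \<in> Q" using F by (auto simp: G_def)
      have "c * \<eta> (k, j) \<le> side k \<and> double_hits \<Gamma> (y (k, j)) (side k) ((A + 1) * side k) (c * \<eta> (k, j))"
        using alt[OF pQ] p pQ by (auto simp: G_def QL_def)
      then show "0 \<le> k \<and> y (k, j) \<in> dcube k j \<and> 0 \<le> c * \<eta> (k, j) \<and> c * \<eta> (k, j) \<le> side k \<and>
        double_hits (f ` {0..1}) (y (k, j)) (side k) ((A + 1) * side k) (c * \<eta> (k, j))"
        using data[OF pQ] pQ c(1) by (auto simp: flat_data_def Q_def \<Gamma>_def)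
    qed (use F in \<open>simp add: G_def\<close>)
    finally show ?thesis using c by (simp add: divide_right_mono)
  qed
  show ?thesis
  proof (rule that[of y l \<eta>])
    show "flat_data \<Gamma> A p (y p) (l p) (\<eta> p)"
      if "0 \<le> fst p" "\<Gamma> \<inter> dcube (fst p) (snd p) \<noteq> {}" for p
      by (rule data) (simp add: Q_def that)
    show "(\<Sum>p\<in>F. (\<eta> p)\<^sup>2 / side (fst p)) \<le> C / c\<^sup>2 + (\<Sum>p\<in>QL. (\<eta> p)\<^sup>2 / side (fst p))"
      if "finite F" "\<forall>p\<in>F. 0 \<le> fst p \<and> \<Gamma> \<inter> dcube (fst p) (snd p) \<noteq> {}" for F
      using that(2) by (intro bound that(1)) (auto simp: Q_def)
  qed
qed

section \<open>Beta numbers of the measure\<close>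

lemma mem_dcube_dil:
  assumes "0 < lam"
  shows "x \<in> dcube_dil lam k j \<longleftrightarrow>
    (\<forall>i. (real_of_int (j i) + 1 / 2 - lam / 2) * side k \<le> x $ i \<and> x $ i < (real_of_int (j i) + 1 / 2 + lam / 2) * side k)"
    (is "_ \<longleftrightarrow> ?R")
proof
  assume "x \<in> dcube_dil lam k j"
  then obtain u where u: "u \<in> dcube k j" "x = dcenter k j + lam *\<^sub>R (u - dcenter k j)"
    by (auto simp: dcube_dil_def)
  show ?R
  proof
    fix i
    have "lam * (real_of_int (j i) * side k) \<le> lam * u $ i" "lam * u $ i < lam * ((real_of_int (j i) + 1) * side k)"
      using u(1) assms by (auto simp: dcube_def)
    then show "(real_of_int (j i) + 1 / 2 - lam / 2) * side k \<le> x $ i \<and> x $ i < (real_of_int (j i) + 1 / 2 + lam / 2) * side k"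
      by (simp add: u(2) dcenter_def algebra_simps)
  qed
next
  assume R: ?R
  define u where "u = dcenter k j + (1 / lam) *\<^sub>R (x - dcenter k j)"
  have "u \<in> dcube k j"
    unfolding dcube_def
  proof (clarsimp, intro allI conjI)
    fix i
    have "lam * u $ i = lam * dcenter k j $ i + (x - dcenter k j) $ i"
      using assms by (simp add: u_def algebra_simps)
    then have "lam * (real_of_int (j i) * side k) \<le> lam * u $ i" "lam * u $ i < lam * ((real_of_int (j i) + 1) * side k)"
      using R[rule_format, of i] by (simp_all add: dcenter_def algebra_simps)
    then show "real_of_int (j i) * side k \<le> u $ i" "u $ i < (real_of_int (j i) + 1) * side k"
      using assms by simp_all
  qed
  moreover have "x = dcenter k j + lam *\<^sub>R (u - dcenter k j)" using assms by (simp add: u_def)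
  ultimately show "x \<in> dcube_dil lam k j" by (auto simp: dcube_dil_def)
qed

lemma dcube_eq_dil: "dcube k j = dcube_dil 1 k j"
  by (simp add: dcube_dil_def)

lemma dist_dcenter_dil_le:
  fixes x :: "real^'n"
  assumes "0 \<le> lam" "x \<in> dcube_dil lam k j"
  shows "dist (dcenter k j) x \<le> lam * real CARD('n) * side k"
proof -
  obtain u where u: "u \<in> dcube k j" "x = dcenter k j + lam *\<^sub>R (u - dcenter k j)"
    using assms(2) by (auto simp: dcube_dil_def)
  have "dist (dcenter k j) x = lam * dist (dcenter k j) u"
    using assms(1) by (simp add: u(2) dist_norm norm_minus_commute)
  also have "\<dots> \<le> lam * (real CARD('n) * side k)" using assms(1) dist_dcenter_le[OF u(1)] by (rule mult_left_mono[rotated])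
  finally show ?thesis by (simp add: mult.assoc)
qed

lemma bounded_dcube_dil: "0 \<le> lam \<Longrightarrow> bounded (dcube_dil lam k (j :: 'n::finite \<Rightarrow> int))"
  by (rule bounded_subset[OF bounded_cball[of "dcenter k j" "lam * real CARD('n) * side k"]])
    (auto dest: dist_dcenter_dil_le)

lemma dcube_dil_borel [measurable]:
  assumes "0 < lam"
  shows "dcube_dil lam k (j :: 'n::finite \<Rightarrow> int) \<in> sets borel"
proof -
  have "dcube_dil lam k j = (\<Inter>i\<in>UNIV. {x. (real_of_int (j i) + 1 / 2 - lam / 2) * side k \<le> x $ i} \<inter>
      {x. x $ i < (real_of_int (j i) + 1 / 2 + lam / 2) * side k})"
    using mem_dcube_dil[OF assms] by blast
  moreover have "\<dots> \<in> sets borel"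
    by (intro sets.finite_INT sets.Int borel_closed borel_open closed_Collect_le open_Collect_less continuous_intros) auto
  ultimately show ?thesis by simp
qed

lemma diameter_dcube_dil_ge: "side k \<le> diameter (dcube_dil 3 k (j :: 'n::finite \<Rightarrow> int))"
proof -
  let ?c = "dcenter k j" and ?d = "dcenter k j + axis (undefined :: 'n) (side k)"
  have "?c \<in> dcube_dil 3 k j" "?d \<in> dcube_dil 3 k j"
    using side_pos[of k] by (simp_all add: mem_dcube_dil dcenter_def axis_def algebra_simps)
  then have "dist ?c ?d \<le> diameter (dcube_dil 3 k j)"
    by (intro diameter_bounded_bound bounded_dcube_dil) auto
  moreover have "side k \<le> dist ?c ?d"
    using component_le_norm_cart[of "axis (undefined :: 'n) (side k)" undefined] by (simp add: dist_norm axis_def)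
  ultimately show ?thesis by linarith
qed

lemma diameter_dcube_le: "diameter (dcube k (j :: 'n::finite \<Rightarrow> int)) \<le> 2 * real CARD('n) * side k"
proof (rule diameter_le)
  fix x y assume "x \<in> dcube k j" "y \<in> dcube k j"
  then show "norm (x - y) \<le> 2 * real CARD('n) * side k"
    using dist_dcenter_le[of x k j] dist_dcenter_le[of y k j] dist_triangle3[of x y "dcenter k j"] by (simp add: dist_norm)
qed (simp add: less_imp_le)

lemma dcube_dil_3_subset:
  "dcube_dil 3 k (j :: 'n::finite \<Rightarrow> int) \<subseteq> dcube_dil (1600 * sqrt (real CARD('n))) k j"
proof
  fix x assume x: "x \<in> dcube_dil 3 k j"
  have n: "1 \<le> sqrt (real CARD('n))" by simp
  have le: "(real_of_int (j i) + 1 / 2 - 1600 * sqrt (real CARD('n)) / 2) * side k \<le> (real_of_int (j i) + 1 / 2 - 3 / 2) * side k"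
    "(real_of_int (j i) + 1 / 2 + 3 / 2) * side k \<le> (real_of_int (j i) + 1 / 2 + 1600 * sqrt (real CARD('n)) / 2) * side k" for i
    by (intro mult_right_mono side_nonneg; use n in linarith)+
  have pos: "0 < 1600 * sqrt (real CARD('n))" using n by linarith
  have x3: "\<forall>i. (real_of_int (j i) + 1 / 2 - 3 / 2) * side k \<le> x $ i \<and> x $ i < (real_of_int (j i) + 1 / 2 + 3 / 2) * side k"
    using x mem_dcube_dil[of 3 x k j] by simp
  show "x \<in> dcube_dil (1600 * sqrt (real CARD('n))) k j"
    unfolding mem_dcube_dil[OF pos]
    by (intro allI conjI order_trans[OF le(1)] order_less_le_trans[OF _ le(2)]) (use x3 in blast)+
qed

lemma side_le_iff: "side k \<le> side k' \<longleftrightarrow> k' \<le> k"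
  by (simp add: side_def)

text \<open>Only the generations \<open>k - 1\<close> and \<open>k\<close> occur, with centres in a
  bounded region. Finiteness makes the real-valued \<open>SUP\<close> in \<open>beta_star_sq\<close>
  one of a bounded family.\<close>

lemma finite_Delta_star: "finite (Delta_star k (j :: 'n::finite \<Rightarrow> int))"
proof -
  let ?R = "1600 * sqrt (real CARD('n)) * real CARD('n)"
  have "Delta_star k j \<subseteq> (\<Union>k'\<in>{k - 1..k}. Pair k' ` {j'. dist (dcenter k' j') (dcenter k j) \<le> ?R * side k'})"
  proof (clarsimp simp: Delta_star_def)
    fix k' and j' :: "'n \<Rightarrow> int"
    assume s: "side k \<le> side k'" "side k' \<le> 2 * side k"
      and sub: "dcube_dil 3 k' j' \<subseteq> dcube_dil (1600 * sqrt (real CARD('n))) k j"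
    have "side (k - 1) = 2 * side k" by (simp add: side_def powr_diff powr_add powr_minus divide_inverse)
    then have k: "k' \<in> {k - 1..k}" using s by (simp add: side_le_iff flip: \<open>side (k - 1) = 2 * side k\<close>)
    have "dcenter k' j' \<in> dcube_dil 3 k' j'"
      using side_pos[of k'] by (simp add: mem_dcube_dil dcenter_def algebra_simps)
    then have "dist (dcenter k j) (dcenter k' j') \<le> ?R * side k"
      using sub by (intro dist_dcenter_dil_le) auto
    also have "\<dots> \<le> ?R * side k'" using s by (intro mult_left_mono) auto
    finally show "\<exists>x\<in>{k - 1..k}. (k', j') \<in> Pair x ` {j'. dist (dcenter x j') (dcenter k j) \<le> ?R * side x}"
      using k by (intro bexI[of _ k']) (auto simp: dist_commute)
  qed
  then show ?thesis
    by (rule finite_subset) (intro finite_UN_I finite_imageI cubes_near(1), auto)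
qed

lemma self_in_Delta_star: "(k, j) \<in> Delta_star k j"
  by (simp add: Delta_star_def dcube_dil_3_subset less_imp_le)

lemma radon_measure_bounded:
  assumes "radon_measure M" "bounded B"
  shows "emeasure M B < \<infinity>"
proof -
  obtain R where "\<forall>x\<in>B. norm x \<le> R" using assms(2) by (auto simp: bounded_iff)
  then have "B \<subseteq> cball 0 R" by auto
  moreover have "cball 0 R \<in> sets M" "emeasure M (cball 0 R) < \<infinity>"
    using assms(1) by (auto simp: radon_measure_def)
  ultimately show ?thesis using emeasure_mono[of B "cball 0 R" M] by (meson order_le_less_trans)
qed

text \<open>Over the reals \<open>INF\<close> and \<open>SUP\<close> are informative only for
  bounded nonempty families: nonnegative terms bound the \<open>INF\<close> from below, and the cube
  itself makes \<open>Delta_star\<close> nonempty.\<close>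

lemma beta_star_sq_le:
  assumes M: "radon_measure M" and l: "l \<in> lines"
    and le: "\<And>k' j'. (k', j') \<in> Delta_star k j \<Longrightarrow>
      beta2sq M (dcube_dil 3 k' j') l * min (measure M (dcube_dil 3 k' j') / diameter (dcube_dil 3 k' j')) 1 \<le> b"
  shows "beta_star_sq M k j \<le> b"
proof -
  let ?t = "\<lambda>l (k', j'). beta2sq M (dcube_dil 3 k' j') l *
     min (measure M (dcube_dil 3 k' j') / diameter (dcube_dil 3 k' j')) 1"
  have nonneg: "0 \<le> ?t l p" for l p
    by (auto simp: beta2sq_def split: prod.split intro!: mult_nonneg_nonneg divide_nonneg_nonneg Bochner_Integration.integral_nonneg diameter_ge_0 bounded_dcube_dil)
  have "0 \<le> (SUP p\<in>Delta_star k j. ?t l p)" for l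
    by (rule cSUP_upper2[OF _ self_in_Delta_star nonneg]) (simp add: finite_Delta_star)
  then have "bdd_below ((\<lambda>l. SUP p\<in>Delta_star k j. ?t l p) ` lines)"
    by (intro bdd_belowI2[of _ 0])
  then have "beta_star_sq M k j \<le> (SUP p\<in>Delta_star k j. ?t l p)"
    unfolding beta_star_sq_def by (rule cINF_lower[OF _ l])
  also have "\<dots> \<le> b"
    by (rule cSUP_least) (use self_in_Delta_star[of k j] le in auto)
  finally show ?thesis .
qed

lemma integrable_indicator_continuous:
  fixes g :: "real^'n \<Rightarrow> real"
  assumes M: "radon_measure M" and X: "X \<in> sets M" "bounded X" and g: "continuous_on UNIV g"
  shows "integrable M (\<lambda>x. indicator X x * g x)"
proof -
  have sets: "sets M = sets borel" using M by (simp add: radon_measure_def)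
  have meas: "g \<in> borel_measurable M"
    using borel_measurable_continuous_onI[OF g] measurable_cong_sets[OF sets refl] by blast
  have "compact (closure X)" using X(2) by (simp add: compact_closure)
  then have "compact (g ` closure X)" by (intro compact_continuous_image continuous_on_subset[OF g]) auto
  then obtain b where "\<forall>y\<in>g ` closure X. norm y \<le> b" using compact_imp_bounded bounded_iff by metis
  then have "\<And>x. x \<in> X \<Longrightarrow> norm (g x) \<le> b" using closure_subset by blast
  then have "integrable M (\<lambda>x. indicator X x *\<^sub>R g x)"
    using X radon_measure_bounded[OF M] meas by (intro integrableI_bounded_set_indicator[of _ _ _ b]) auto
  then show ?thesis by simp
qed

text \<open>Square the hypothesis with
  \<open>(u + v)\<^sup>2 \<le> 2 * u\<^sup>2 + 2 * v\<^sup>2\<close>. Every competing triple lies in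
  the large dilate and has diameter at least \<open>side k\<close>, so one bound serves all of
  them.\<close>

lemma beta_star_sq_bound:
  fixes M :: "(real^'n) measure"
  assumes M: "radon_measure M" and l: "l \<in> lines" and \<eta>: "0 \<le> \<eta>"
    and le: "\<And>x. x \<in> dcube_dil (1600 * sqrt (real CARD('n))) k j \<Longrightarrow> infdist x l \<le> infdist x \<Gamma> + \<eta>"
  shows "beta_star_sq M k j \<le> 2 * \<eta>\<^sup>2 / (side k)\<^sup>2 +
    2 / (side k) ^ 3 * (\<integral>x. indicator (dcube_dil (1600 * sqrt (real CARD('n))) k j) x * (infdist x \<Gamma>)\<^sup>2 \<partial>M)"
proof (rule beta_star_sq_le[OF M l])
  fix k' j' assume D: "(k', j') \<in> Delta_star k j"
  define E where "E = dcube_dil (1600 * sqrt (real CARD('n))) k j"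
  define B where "B = dcube_dil 3 k' j'"
  have sets: "sets M = sets borel" using M by (simp add: radon_measure_def)
  have E: "E \<in> sets M" "bounded E" unfolding E_def sets
    by (auto intro!: dcube_dil_borel bounded_dcube_dil)
  have B: "B \<in> sets M" "bounded B" unfolding B_def sets
    by (auto intro!: dcube_dil_borel bounded_dcube_dil)
  note int = integrable_indicator_continuous[OF M]
  have BE: "B \<subseteq> E" and s: "side k \<le> side k'" using D by (auto simp: Delta_star_def B_def E_def)
  define d where "d = diameter B"
  have d: "side k \<le> d" using diameter_dcube_dil_ge[of k' j'] s by (simp add: d_def B_def)
  have d0: "0 < d" "0 < side k" using d side_pos[of k] by linarith+
  define I where "I = (\<integral>x. indicator E x * (infdist x \<Gamma>)\<^sup>2 \<partial>M)"
  have I0: "0 \<le> I" unfolding I_def by (intro Bochner_Integration.integral_nonneg) auto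
  have "(side k)\<^sup>2 \<le> d\<^sup>2" "(side k) ^ 3 \<le> d ^ 3" by (intro power_mono d; simp)+
  then have rhs: "2 * \<eta>\<^sup>2 / d\<^sup>2 \<le> 2 * \<eta>\<^sup>2 / (side k)\<^sup>2" "2 / d ^ 3 * I \<le> 2 / (side k) ^ 3 * I"
    by (intro divide_left_mono mult_right_mono I0 mult_pos_pos zero_less_power d0; simp)+
  show "beta2sq M (dcube_dil 3 k' j') l * min (measure M (dcube_dil 3 k' j') / diameter (dcube_dil 3 k' j')) 1
      \<le> 2 * \<eta>\<^sup>2 / (side k)\<^sup>2 + 2 / (side k) ^ 3 * (\<integral>x. indicator (dcube_dil (1600 * sqrt (real CARD('n))) k j) x * (infdist x \<Gamma>)\<^sup>2 \<partial>M)"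
    unfolding E_def[symmetric] B_def[symmetric] d_def[symmetric] I_def[symmetric]
  proof (cases "measure M B = 0")
    case True
    then show "beta2sq M B l * min (measure M B / d) 1 \<le> 2 * \<eta>\<^sup>2 / (side k)\<^sup>2 + 2 / (side k) ^ 3 * I"
      using I0 d0 by (simp add: beta2sq_def)
  next
    case False
    define m where "m = measure M B"
    have m: "0 < m" using False by (simp add: m_def zero_less_measure_iff)
    have "(\<integral>x. indicator B x * (infdist x l / d)\<^sup>2 \<partial>M)
        \<le> (\<integral>x. indicator E x * (infdist x \<Gamma>)\<^sup>2 * (2 / d\<^sup>2) + indicator B x * (2 * \<eta>\<^sup>2 / d\<^sup>2) \<partial>M)"
    proof (rule integral_mono)
      show "integrable M (\<lambda>x. indicator B x * (infdist x l / d)\<^sup>2)"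
        using d0 by (intro int B continuous_intros) auto
      show "integrable M (\<lambda>x. indicator E x * (infdist x \<Gamma>)\<^sup>2 * (2 / d\<^sup>2) + indicator B x * (2 * \<eta>\<^sup>2 / d\<^sup>2))"
        by (intro Bochner_Integration.integrable_add integrable_mult_left int B E continuous_intros)
      fix x
      show "indicator B x * (infdist x l / d)\<^sup>2 \<le> indicator E x * (infdist x \<Gamma>)\<^sup>2 * (2 / d\<^sup>2) + indicator B x * (2 * \<eta>\<^sup>2 / d\<^sup>2)"
      proof (cases "x \<in> B")
        case True
        then have xE: "x \<in> E" using BE by blast
        have "(infdist x l)\<^sup>2 \<le> (infdist x \<Gamma> + \<eta>)\<^sup>2"
          using le[of x] xE by (intro power_mono) (auto simp: E_def infdist_nonneg)
        also have "\<dots> \<le> 2 * (infdist x \<Gamma>)\<^sup>2 + 2 * \<eta>\<^sup>2"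
          using zero_le_power2[of "infdist x \<Gamma> - \<eta>"] by (simp add: power2_sum power2_diff)
        finally have "(infdist x l)\<^sup>2 / d\<^sup>2 \<le> (2 * (infdist x \<Gamma>)\<^sup>2 + 2 * \<eta>\<^sup>2) / d\<^sup>2"
          by (rule divide_right_mono) simp
        then show ?thesis using True xE by (simp add: power_divide add_divide_distrib mult.commute)
      next
        case False
        then show ?thesis by simp
      qed
    qed
    also have "\<dots> = I * (2 / d\<^sup>2) + m * (2 * \<eta>\<^sup>2 / d\<^sup>2)"
    proof -
      have "(\<integral>x. indicator E x * (infdist x \<Gamma>)\<^sup>2 * (2 / d\<^sup>2) + indicator B x * (2 * \<eta>\<^sup>2 / d\<^sup>2) \<partial>M)
        = (\<integral>x. indicator E x * (infdist x \<Gamma>)\<^sup>2 * (2 / d\<^sup>2) \<partial>M) + (\<integral>x. indicator B x * (2 * \<eta>\<^sup>2 / d\<^sup>2) \<partial>M)"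
        by (intro Bochner_Integration.integral_add integrable_mult_left int B E continuous_intros)
      moreover have "(\<integral>x. indicator B x * (2 * \<eta>\<^sup>2 / d\<^sup>2) \<partial>M) = m * (2 * \<eta>\<^sup>2 / d\<^sup>2)"
        using B(1) sets.sets_into_space[OF B(1)] by (simp add: m_def Int_absorb2)
      ultimately show ?thesis by (simp only: I_def integral_mult_left_zero)
    qed
    finally have le2: "(\<integral>x. indicator B x * (infdist x l / d)\<^sup>2 \<partial>M) / m \<le> (I * (2 / d\<^sup>2) + m * (2 * \<eta>\<^sup>2 / d\<^sup>2)) / m"
      using m by (intro divide_right_mono) auto
    have "beta2sq M B l * min (m / d) 1 \<le> (I * (2 / d\<^sup>2) + m * (2 * \<eta>\<^sup>2 / d\<^sup>2)) / m * min (m / d) 1"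
      using le2 m d0 False by (intro mult_right_mono) (auto simp: beta2sq_def m_def d_def)
    also have "\<dots> = I * (2 / d\<^sup>2) / m * min (m / d) 1 + (2 * \<eta>\<^sup>2 / d\<^sup>2) * min (m / d) 1"
      using m by (simp add: add_divide_distrib algebra_simps)
    \<comment> \<open>The weight is estimated by \<open>m / d\<close> in the first term, which
      removes the unknown mass \<open>m\<close>, and by 1 in the second, where the mass has already
      cancelled.\<close>
    also have "\<dots> \<le> I * (2 / d\<^sup>2) / m * (m / d) + (2 * \<eta>\<^sup>2 / d\<^sup>2) * 1"
      using m I0 d0 by (intro add_mono mult_left_mono) auto
    also have "I * (2 / d\<^sup>2) / m * (m / d) = 2 / d ^ 3 * I"
      using m by (simp add: power2_eq_square power3_eq_cube)
    finally show "beta2sq M B l * min (measure M B / d) 1 \<le> 2 * \<eta>\<^sup>2 / (side k)\<^sup>2 + 2 / (side k) ^ 3 * I"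
      using rhs by (simp add: m_def)
  qed
qed

text \<open>The terms grow by the factor 4, so those below the cutoff add up to at most
  \<open>1 + 1/4 + 1/16 + ... = 4/3\<close> times the last one, which is at most
  \<open>b\<^sup>2\<close>.\<close>

lemma sum_geometric_le:
  fixes a b :: real
  assumes "0 \<le> a" "0 \<le> b"
  shows "(\<Sum>k<K. if a * 2 ^ k \<le> b then (a * 2 ^ k)\<^sup>2 else 0) \<le> 4 / 3 * b\<^sup>2"
proof (induction K)
  case 0
  then show ?case by simp
next
  case (Suc K)
  have sq: "(a * 2 ^ k)\<^sup>2 = a\<^sup>2 * 4 ^ k" for k
    by (simp add: power_mult_distrib power2_eq_square flip: power_mult_distrib)
  show ?case
  proof (cases "a * 2 ^ K \<le> b")
    case True
    have "(\<Sum>k<Suc K. if a * 2 ^ k \<le> b then (a * 2 ^ k)\<^sup>2 else 0) \<le> (\<Sum>k<Suc K. a\<^sup>2 * 4 ^ k)"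
      by (intro sum_mono) (simp add: sq)
    also have "\<dots> \<le> 4 / 3 * (a * 2 ^ K)\<^sup>2"
    proof -
      have "(\<Sum>k<Suc K. 4 ^ k :: real) \<le> 4 / 3 * 4 ^ K" by (induction K) auto
      then have "a\<^sup>2 * (\<Sum>k<Suc K. 4 ^ k) \<le> a\<^sup>2 * (4 / 3 * 4 ^ K)" by (intro mult_left_mono) auto
      then show ?thesis unfolding sum_distrib_left[symmetric] sq by (simp only: mult.left_commute)
    qed
    also have "\<dots> \<le> 4 / 3 * b\<^sup>2" using True assms by (intro mult_left_mono power_mono) auto
    finally show ?thesis .
  next
    case False
    then show ?thesis using Suc by simp
  qed
qed

text \<open>A point at distance \<open>g\<close> from \<open>\<Gamma>\<close> is seen only by cubes of side at least a multiple of \<open>g\<close>, boundedly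
  many of each generation, so the sum is geometric.\<close>
lemma sum_infdist_bounded:
  fixes M :: "(real^'n) measure" and \<Gamma> :: "(real^'n) set"
  assumes M: "radon_measure M" and \<Gamma>: "bounded \<Gamma>"
  obtains C where "\<And>G. finite G \<Longrightarrow> \<forall>p\<in>G. 0 \<le> fst p \<and> \<Gamma> \<inter> dcube (fst p) (snd p) \<noteq> {} \<Longrightarrow>
    (\<Sum>p\<in>G. 1 / (side (fst p))\<^sup>2 *
      (\<integral>x. indicator (dcube_dil (1600 * sqrt (real CARD('n))) (fst p) (snd p)) x * (infdist x \<Gamma>)\<^sup>2 \<partial>M)) \<le> C"
proof -
  define E where "E p = dcube_dil (1600 * sqrt (real CARD('n))) (fst p) (snd p)" for p :: "int \<times> ('n \<Rightarrow> int)"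
  \<comment> \<open>In units of the side: the first summand bounds the distance from the centre to a
    curve point in the cube, the second that from the centre to a point of the dilate.\<close>
  define A where "A = real CARD('n) + 1600 * sqrt (real CARD('n)) * real CARD('n)"
  define N where "N = (nat \<lfloor>2 * A\<rfloor> + 2) ^ CARD('n)"
  obtain R where R: "\<forall>x\<in>\<Gamma>. norm x \<le> R" using \<Gamma> by (auto simp: bounded_iff)
  have A0: "0 \<le> A" by (simp add: A_def)
  have sets: "sets M = sets borel" using M by (simp add: radon_measure_def)
  \<comment> \<open>As sides are at most 1, the dilates of all cubes meeting \<open>\<Gamma>\<close>
    lie in this ball, whose measure is finite.\<close>
  define U where "U = cball (0 :: real^'n) (R + A)"
  have E: "E p \<in> sets M" "bounded (E p)" for p
    unfolding E_def sets by (auto intro!: dcube_dil_borel bounded_dcube_dil)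
  have "(\<Sum>p\<in>G. 1 / (side (fst p))\<^sup>2 * (\<integral>x. indicator (E p) x * (infdist x \<Gamma>)\<^sup>2 \<partial>M))
      \<le> (\<integral>x. indicator U x * (real N * (4 / 3 * A\<^sup>2)) \<partial>M)"
    if fin: "finite G" and meets: "\<forall>p\<in>G. 0 \<le> fst p \<and> \<Gamma> \<inter> dcube (fst p) (snd p) \<noteq> {}" for G
  proof -
    have G: "finite G" "\<And>p. p \<in> G \<Longrightarrow> 0 \<le> fst p \<and> \<Gamma> \<inter> dcube (fst p) (snd p) \<noteq> {}"
      using fin meets by auto
    have near: "infdist x \<Gamma> \<le> A * side (fst p)" "dist (dcenter (fst p) (snd p)) x \<le> A * side (fst p)" "x \<in> U"
      if p: "p \<in> G" and x: "x \<in> E p" for p x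
    proof -
      obtain y where y: "y \<in> \<Gamma>" "y \<in> dcube (fst p) (snd p)" using G(2)[OF p] by blast
      have 1: "dist (dcenter (fst p) (snd p)) x \<le> 1600 * sqrt (real CARD('n)) * real CARD('n) * side (fst p)"
        using x unfolding E_def by (intro dist_dcenter_dil_le) auto
      also have "\<dots> \<le> A * side (fst p)" unfolding A_def by (intro mult_right_mono) auto
      finally show "dist (dcenter (fst p) (snd p)) x \<le> A * side (fst p)" .
      have 2: "dist y x \<le> A * side (fst p)"
        using dist_dcenter_le[OF y(2)] 1 dist_triangle3[of y x "dcenter (fst p) (snd p)"]
        by (simp add: A_def algebra_simps)
      then show "infdist x \<Gamma> \<le> A * side (fst p)"
        using infdist_le[OF y(1), of x] by (simp add: dist_commute)
      have "side (fst p) \<le> side 0" using G(2)[OF p] by (simp add: side_le_iff)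
      then have "side (fst p) \<le> 1" by (simp add: side_def)
      then have "A * side (fst p) \<le> A * 1" using A0 by (intro mult_left_mono)
      then have "dist y x \<le> A" using 2 by simp
      moreover have "norm x \<le> norm y + dist y x"
        by (metis add.commute dist_commute dist_norm norm_triangle_sub)
      ultimately show "x \<in> U" using R y(1) unfolding U_def by force
    qed
    have int: "integrable M (\<lambda>x. indicator (E p) x * (infdist x \<Gamma>)\<^sup>2)" for p
      by (intro integrable_indicator_continuous[OF M] E continuous_intros)
    obtain K where K: "\<And>p. p \<in> G \<Longrightarrow> nat (fst p) < K"
    proof -
      have "finite ((\<lambda>p. nat (fst p)) ` G)" using G(1) by simp
      then obtain K where "\<forall>k\<in>(\<lambda>p. nat (fst p)) ` G. k < K" using finite_nat_set_iff_bounded by blast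
      then show ?thesis using that by blast
    qed
    have "(\<Sum>p\<in>G. 1 / (side (fst p))\<^sup>2 * (\<integral>x. indicator (E p) x * (infdist x \<Gamma>)\<^sup>2 \<partial>M))
        = (\<integral>x. (\<Sum>p\<in>G. 1 / (side (fst p))\<^sup>2 * (indicator (E p) x * (infdist x \<Gamma>)\<^sup>2)) \<partial>M)"
      by (subst Bochner_Integration.integral_sum) (use int in auto)
    also have "\<dots> \<le> (\<integral>x. indicator U x * (real N * (4 / 3 * A\<^sup>2)) \<partial>M)"
    proof (rule integral_mono)
      show "integrable M (\<lambda>x. \<Sum>p\<in>G. 1 / (side (fst p))\<^sup>2 * (indicator (E p) x * (infdist x \<Gamma>)\<^sup>2))"
        using int by (intro Bochner_Integration.integrable_sum integrable_mult_right)
      show "integrable M (\<lambda>x. indicator U x * (real N * (4 / 3 * A\<^sup>2)))"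
        by (intro integrable_indicator_continuous[OF M]) (auto simp: U_def sets)
      fix x
      define g where "g = infdist x \<Gamma>"
      have g0: "0 \<le> g" by (simp add: g_def infdist_nonneg)
      define H where "H = {p \<in> G. x \<in> E p}"
      have finH: "finite H" using G(1) by (simp add: H_def)
      have eq: "(\<Sum>p\<in>G. 1 / (side (fst p))\<^sup>2 * (indicator (E p) x * (infdist x \<Gamma>)\<^sup>2))
          = (\<Sum>p\<in>H. (g * 2 ^ nat (fst p))\<^sup>2)"
      proof -
        have "(\<Sum>p\<in>G. 1 / (side (fst p))\<^sup>2 * (indicator (E p) x * (infdist x \<Gamma>)\<^sup>2))
            = (\<Sum>p\<in>G. if x \<in> E p then (g * 2 ^ nat (fst p))\<^sup>2 else 0)"
        proof (rule sum.cong[OF refl])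
          fix p assume "p \<in> G"
          then have "side (fst p) = (1 / 2) ^ nat (fst p)" using G(2)[of p] side_nat[of "nat (fst p)"] by simp
          then show "1 / (side (fst p))\<^sup>2 * (indicator (E p) x * (infdist x \<Gamma>)\<^sup>2)
              = (if x \<in> E p then (g * 2 ^ nat (fst p))\<^sup>2 else 0)"
            by (simp add: g_def power_one_over power_mult_distrib)
        qed
        also have "\<dots> = (\<Sum>p\<in>H. (g * 2 ^ nat (fst p))\<^sup>2)"
          unfolding H_def using G(1) by (intro sum.inter_filter[symmetric])
        finally show ?thesis .
      qed
      show "(\<Sum>p\<in>G. 1 / (side (fst p))\<^sup>2 * (indicator (E p) x * (infdist x \<Gamma>)\<^sup>2))
          \<le> indicator U x * (real N * (4 / 3 * A\<^sup>2))"
      proof (cases "H = {}")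
        case True
        then show ?thesis unfolding eq by simp
      next
        case False
        then have xU: "x \<in> U" using near(3) by (auto simp: H_def)
        have "(\<Sum>p\<in>H. (g * 2 ^ nat (fst p))\<^sup>2) = (\<Sum>k<K. \<Sum>p\<in>{p \<in> H. nat (fst p) = k}. (g * 2 ^ nat (fst p))\<^sup>2)"
          using K finH by (intro sum.group[symmetric]) (auto simp: H_def)
        also have "\<dots> \<le> (\<Sum>k<K. real N * (if g * 2 ^ k \<le> A then (g * 2 ^ k)\<^sup>2 else 0))"
        proof (rule sum_mono)
          fix k
          let ?H = "{p \<in> H. nat (fst p) = k}"
          have Hk: "fst p = int k" "g * 2 ^ k \<le> A" "snd p \<in> {j. dist (dcenter (int k) j) x \<le> A * side (int k)}" if "p \<in> ?H" for p
          proof -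
            have p: "p \<in> G" "x \<in> E p" using that by (auto simp: H_def)
            show k: "fst p = int k" using G(2)[OF p(1)] that by auto
            have "g \<le> A * (1 / 2) ^ k" using near(1)[OF p] by (simp add: k side_nat g_def)
            then show "g * 2 ^ k \<le> A" by (simp add: power_one_over field_simps)
            show "snd p \<in> {j. dist (dcenter (int k) j) x \<le> A * side (int k)}" using near(2)[OF p] by (simp add: k)
          qed
          have "card ?H \<le> card {j :: 'n \<Rightarrow> int. dist (dcenter (int k) j) x \<le> A * side (int k)}"
          proof (rule card_inj_on_le[where f = snd])
            show "inj_on snd ?H"
            proof (rule inj_onI)
              fix p q assume "p \<in> ?H" "q \<in> ?H" "snd p = snd q"
              then show "p = q" using Hk(1)[of p] Hk(1)[of q] by (metis prod_eq_iff)
            qed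
            show "snd ` ?H \<subseteq> {j. dist (dcenter (int k) j) x \<le> A * side (int k)}" using Hk(3) by blast
          qed (rule cubes_near(1)[OF A0])
          also have "\<dots> \<le> N" unfolding N_def by (rule cubes_near(2)[OF A0])
          finally have card: "real (card ?H) \<le> real N" by simp
          have "(\<Sum>p\<in>?H. (g * 2 ^ nat (fst p))\<^sup>2) = real (card ?H) * (g * 2 ^ k)\<^sup>2" by simp
          also have "\<dots> \<le> real N * (if g * 2 ^ k \<le> A then (g * 2 ^ k)\<^sup>2 else 0)"
          proof (cases "?H = {}")
            case False
            then have "g * 2 ^ k \<le> A" using Hk(2) by blast
            then show ?thesis using card by (simp add: mult_right_mono)
          next
            case True
            then have "card ?H = 0" by (simp only: card.empty)
            then show ?thesis by (simp only:) simp
          qed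
          finally show "(\<Sum>p\<in>?H. (g * 2 ^ nat (fst p))\<^sup>2) \<le> real N * (if g * 2 ^ k \<le> A then (g * 2 ^ k)\<^sup>2 else 0)" .
        qed
        also have "\<dots> \<le> real N * (4 / 3 * A\<^sup>2)"
          unfolding sum_distrib_left[symmetric] by (intro mult_left_mono sum_geometric_le g0 A0) simp
        finally show ?thesis unfolding eq using xU by simp
      qed
    qed
    finally show ?thesis .
  qed
  then show ?thesis using that unfolding E_def by blast
qed

section \<open>Summation over the cubes meeting the curve\<close>

lemma rectifiable_curve_compact: "rectifiable_curve \<Gamma> \<Longrightarrow> compact \<Gamma>"
  unfolding rectifiable_curve_def
  by (auto intro!: compact_continuous_image intro: lipschitz_on_continuous_on)

text \<open>Multiplying the bound of \<open>beta_star_sq_bound\<close> by the diameter lowers both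
  powers of the side in the denominators by one, which leaves exactly the two quantities already
  summed.\<close>

lemma curve_sum_bounded:
  fixes M :: "(real^'n) measure" and \<Gamma> :: "(real^'n) set"
  assumes M: "radon_measure M" and \<Gamma>: "rectifiable_curve \<Gamma>"
  obtains C where "\<And>G. finite G \<Longrightarrow> \<forall>p\<in>G. 0 \<le> fst p \<and> \<Gamma> \<inter> dcube (fst p) (snd p) \<noteq> {} \<Longrightarrow>
    (\<Sum>p\<in>G. ennreal (beta_star_sq M (fst p) (snd p)) * ennreal (diameter (dcube (fst p) (snd p)))) \<le> ennreal C"
proof -
  obtain f :: "real \<Rightarrow> real^'n" and L where f: "L-lipschitz_on {0..1} f" and \<Gamma>f: "\<Gamma> = f ` {0..1}"
    using \<Gamma> unfolding rectifiable_curve_def by blast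
  have comp: "compact \<Gamma>" by (rule rectifiable_curve_compact[OF \<Gamma>])
  define n where "n = real CARD('n)"
  have n: "1 \<le> n" by (simp add: n_def Suc_leI)
  define A where "A = n + 1600 * sqrt n * n"
  have A: "1 \<le> A" using n by (simp add: A_def add_increasing2)
  \<comment> \<open>Flatness is needed at twice the scale: a point of \<open>E p\<close> lies within
    \<open>A\<close> sides of \<open>y p\<close>, and its nearest curve point may be another
    \<open>A\<close> sides away.\<close>
  then have A2: "1 \<le> 2 * A" by simp
  define E where "E p = dcube_dil (1600 * sqrt (real CARD('n))) (fst p) (snd p)" for p :: "int \<times> ('n \<Rightarrow> int)"
  define I where "I p = (\<integral>x. indicator (E p) x * (infdist x \<Gamma>)\<^sup>2 \<partial>M)" for p
  obtain y l \<eta> C1 where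
    data: "\<And>p. 0 \<le> fst p \<Longrightarrow> \<Gamma> \<inter> dcube (fst p) (snd p) \<noteq> {} \<Longrightarrow> flat_data \<Gamma> (2 * A) p (y p) (l p) (\<eta> p)" and
    C1: "\<And>F. finite F \<Longrightarrow> \<forall>p\<in>F. 0 \<le> fst p \<and> \<Gamma> \<inter> dcube (fst p) (snd p) \<noteq> {} \<Longrightarrow>
      (\<Sum>p\<in>F. (\<eta> p)\<^sup>2 / side (fst p)) \<le> C1"
  proof (rule traveling_salesman_necessity[OF f A2, folded \<Gamma>f], goal_cases)
    case (1 y l \<eta> C)
    show thesis by (rule 1(1)[of y l \<eta> C], erule (1) 1(2), erule (1) 1(3))
  qed
  obtain C2 where C2: "\<And>G. finite G \<Longrightarrow> \<forall>p\<in>G. 0 \<le> fst p \<and> \<Gamma> \<inter> dcube (fst p) (snd p) \<noteq> {} \<Longrightarrow>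
    (\<Sum>p\<in>G. 1 / (side (fst p))\<^sup>2 * I p) \<le> C2"
    using sum_infdist_bounded[OF M compact_imp_bounded[OF comp]] unfolding I_def E_def by blast
  have le_w: "ennreal (beta_star_sq M (fst p) (snd p)) * ennreal (diameter (dcube (fst p) (snd p)))
      \<le> ennreal (4 * n * ((\<eta> p)\<^sup>2 / side (fst p) + 1 / (side (fst p))\<^sup>2 * I p))"
    if p: "0 \<le> fst p" "\<Gamma> \<inter> dcube (fst p) (snd p) \<noteq> {}" for p
  proof -
    let ?s = "side (fst p)"
    have fd: "y p \<in> \<Gamma>" "y p \<in> dcube (fst p) (snd p)" "l p \<in> lines" "0 \<le> \<eta> p"
      "\<And>x. x \<in> \<Gamma> \<Longrightarrow> dist (y p) x \<le> 2 * A * ?s \<Longrightarrow> infdist x (l p) \<le> \<eta> p"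
      using data[OF p] by (auto simp: flat_data_def)
    have near: "infdist x (l p) \<le> infdist x \<Gamma> + \<eta> p" if x: "x \<in> E p" for x
    proof -
      have "dist (dcenter (fst p) (snd p)) x \<le> 1600 * sqrt n * n * ?s"
        using x unfolding E_def n_def by (intro dist_dcenter_dil_le) auto
      then have yx: "dist (y p) x \<le> A * ?s"
        using dist_dcenter_le[OF fd(2)] dist_triangle3[of "y p" x "dcenter (fst p) (snd p)"]
        by (simp add: A_def n_def algebra_simps)
      obtain z where z: "z \<in> \<Gamma>" "infdist x \<Gamma> = dist x z"
        using infdist_attains_inf[OF compact_imp_closed[OF comp], of x] fd(1) by blast
      have "dist x z \<le> dist x (y p)" using infdist_le[OF fd(1), of x] z(2) by simp
      then have "dist (y p) z \<le> 2 * A * ?s"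
        using yx dist_triangle[of "y p" z x] by (simp add: dist_commute)
      then have "infdist z (l p) \<le> \<eta> p" by (rule fd(5)[OF z(1)])
      then show ?thesis using infdist_triangle[of x "l p" z] z(2) by linarith
    qed
    have "beta_star_sq M (fst p) (snd p) \<le> 2 * (\<eta> p)\<^sup>2 / ?s\<^sup>2 + 2 / ?s ^ 3 * I p"
      unfolding I_def E_def
      by (rule beta_star_sq_bound[OF M fd(3,4)]) (use near in \<open>simp add: E_def\<close>)
    moreover have I0: "0 \<le> I p" unfolding I_def by (intro Bochner_Integration.integral_nonneg) auto
    ultimately have "ennreal (beta_star_sq M (fst p) (snd p)) * ennreal (diameter (dcube (fst p) (snd p)))
        \<le> ennreal (2 * (\<eta> p)\<^sup>2 / ?s\<^sup>2 + 2 / ?s ^ 3 * I p) * ennreal (2 * n * ?s)"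
      using diameter_dcube_le[of "fst p" "snd p"] by (intro mult_mono ennreal_leI) (auto simp: n_def)
    also have "\<dots> = ennreal ((2 * (\<eta> p)\<^sup>2 / ?s\<^sup>2 + 2 / ?s ^ 3 * I p) * (2 * n * ?s))"
      using I0 n by (intro ennreal_mult[symmetric]) auto
    also have "(2 * (\<eta> p)\<^sup>2 / ?s\<^sup>2 + 2 / ?s ^ 3 * I p) * (2 * n * ?s) = 4 * n * ((\<eta> p)\<^sup>2 / ?s + 1 / ?s\<^sup>2 * I p)"
    proof -
      have "?s \<noteq> 0" using side_pos[of "fst p"] by linarith
      then show ?thesis by (simp add: power2_eq_square power3_eq_cube field_simps)
    qed
    finally show ?thesis .
  qed
  have I0: "0 \<le> I p" for p unfolding I_def by (intro Bochner_Integration.integral_nonneg) auto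
  have "(\<Sum>p\<in>G. ennreal (beta_star_sq M (fst p) (snd p)) * ennreal (diameter (dcube (fst p) (snd p))))
      \<le> ennreal (4 * n * (C1 + C2))"
    if G: "finite G" "\<forall>p\<in>G. 0 \<le> fst p \<and> \<Gamma> \<inter> dcube (fst p) (snd p) \<noteq> {}" for G
  proof -
    have "(\<Sum>p\<in>G. ennreal (beta_star_sq M (fst p) (snd p)) * ennreal (diameter (dcube (fst p) (snd p))))
        \<le> (\<Sum>p\<in>G. ennreal (4 * n * ((\<eta> p)\<^sup>2 / side (fst p) + 1 / (side (fst p))\<^sup>2 * I p)))"
      using G(2) by (intro sum_mono le_w) auto
    also have "\<dots> = ennreal (\<Sum>p\<in>G. 4 * n * ((\<eta> p)\<^sup>2 / side (fst p) + 1 / (side (fst p))\<^sup>2 * I p))"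
      using n I0 by (intro sum_ennreal) (auto intro!: mult_nonneg_nonneg add_nonneg_nonneg)
    also have "(\<Sum>p\<in>G. 4 * n * ((\<eta> p)\<^sup>2 / side (fst p) + 1 / (side (fst p))\<^sup>2 * I p))
        = 4 * n * ((\<Sum>p\<in>G. (\<eta> p)\<^sup>2 / side (fst p)) + (\<Sum>p\<in>G. 1 / (side (fst p))\<^sup>2 * I p))"
      by (simp only: sum_distrib_left[symmetric] sum.distrib)
    also have "ennreal \<dots> \<le> ennreal (4 * n * (C1 + C2))"
      using n C1[OF G] C2[OF G] by (intro ennreal_leI mult_left_mono add_mono) auto
    finally show ?thesis .
  qed
  then show ?thesis using that by blast
qed

text \<open>Enumerating the cubes turns the unordered sum into a series, for which measurability and
  the exchange with the integral are at hand.\<close>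

lemma infsum_ennreal_eq_suminf:
  fixes g :: "'a \<Rightarrow> ennreal"
  assumes "bij_betw e (UNIV :: nat set) K"
  shows "(\<Sum>\<^sub>\<infinity>p\<in>K. g p) = (\<Sum>n. g (e n))"
proof -
  have "(\<Sum>\<^sub>\<infinity>p\<in>K. g p) = (\<Sum>\<^sub>\<infinity>n. g (e n))"
    by (rule infsum_reindex_bij_betw[OF assms, symmetric])
  moreover have "((\<lambda>n. g (e n)) has_sum (\<Sum>\<^sub>\<infinity>n. g (e n))) UNIV"
    by (intro has_sum_infsum nonneg_summable_on_complete) simp
  then have "(\<lambda>n. g (e n)) sums (\<Sum>\<^sub>\<infinity>n. g (e n))" by (rule has_sum_imp_sums)
  ultimately show ?thesis by (simp add: sums_iff)
qed

text \<open>If \<open>b = 0\<close> then \<open>c = 0\<close> too, and infinity times 0 is 0: a cube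
  of measure zero adds nothing to the integral even where its term in \<open>J_star2\<close> is
  infinite.\<close>

lemma ennreal_divide_mult_le:
  fixes a b c :: ennreal
  assumes "c \<le> b" "b < \<infinity>"
  shows "a / b * c \<le> a"
proof (cases "b = 0")
  case True
  then show ?thesis using assms by simp
next
  case False
  have "a / b * c \<le> a / b * b" using assms by (intro mult_left_mono) auto
  also have "\<dots> = a" using False assms(2) by (simp add: ennreal_divide_times ennreal_divide_self)
  finally show ?thesis .
qed

theorem theorem4p3:
  fixes M :: "(real^'n) measure" and \<Gamma> :: "(real^'n) set"
  assumes "CARD('n) \<ge> 2"
    and "radon_measure M"
    and "rectifiable_curve \<Gamma>"
  shows "J_star2 M \<in> borel_measurable M
    \<and> (\<integral>\<^sup>+ x. J_star2 M x * indicator \<Gamma> x \<partial>M) < \<infinity>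
    \<and> (AE x in M. x \<in> \<Gamma> \<longrightarrow> J_star2 M x < \<infinity>)"
proof -
  have sets: "sets M = sets borel" using assms(2) by (simp add: radon_measure_def)
  define K where "K = {(k :: int, j :: 'n \<Rightarrow> int). 0 \<le> k}"
  define D where "D p = dcube (fst p) (snd p)" for p :: "int \<times> ('n \<Rightarrow> int)"
  define w where "w p = ennreal (beta_star_sq M (fst p) (snd p)) * ennreal (diameter (D p))" for p
  have D: "D p \<in> sets M" "bounded (D p)" for p
    unfolding D_def dcube_eq_dil sets by (auto intro!: dcube_dil_borel bounded_dcube_dil)
  have "infinite K"
  proof
    assume "finite K"
    then have "finite (fst ` K)" by simp
    moreover have "fst ` K = {0..}" by (force simp: K_def)
    ultimately show False using infinite_Ici[of "0 :: int"] by simp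
  qed
  moreover have "countable K" by (rule countable_subset[OF subset_UNIV]) simp
  ultimately obtain e where e: "bij_betw e (UNIV :: nat set) K"
    using countableE_infinite bij_betw_inv_into by metis
  have J: "J_star2 M x = (\<Sum>n. w (e n) / emeasure M (D (e n)) * indicator (D (e n)) x)" for x
  proof -
    have "J_star2 M x = (\<Sum>\<^sub>\<infinity>p\<in>K. w p / emeasure M (D p) * indicator (D p) x)"
      unfolding J_star2_def K_def[symmetric] w_def D_def by (rule infsum_cong) (simp add: split_beta)
    then show ?thesis by (simp add: infsum_ennreal_eq_suminf[OF e])
  qed
  have meas: "J_star2 M \<in> borel_measurable M"
  proof -
    have J': "J_star2 M = (\<lambda>x. \<Sum>n. w (e n) / emeasure M (D (e n)) * indicator (D (e n)) x)"
      by (rule ext) (rule J)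
    show ?thesis
      unfolding J' by (intro borel_measurable_suminf_order borel_measurable_times_ennreal borel_measurable_const
          borel_measurable_indicator D(1))
  qed
  have "compact \<Gamma>" by (rule rectifiable_curve_compact[OF assms(3)])
  then have \<Gamma>: "\<Gamma> \<in> sets M" unfolding sets by (intro borel_compact)
  obtain C where C: "\<And>G. finite G \<Longrightarrow> \<forall>p\<in>G. 0 \<le> fst p \<and> \<Gamma> \<inter> D p \<noteq> {} \<Longrightarrow> (\<Sum>p\<in>G. w p) \<le> ennreal C"
    using curve_sum_bounded[OF assms(2,3)] unfolding w_def D_def by blast
  \<comment> \<open>Integration over \<open>\<Gamma>\<close> cancels the mass of the cube, and cubes
    missing \<open>\<Gamma>\<close> drop out; the bound \<open>C\<close> covers only the
    others.\<close>
  have le_w: "(\<integral>\<^sup>+ x. w p / emeasure M (D p) * indicator (D p) x * indicator \<Gamma> x \<partial>M) \<le> (if \<Gamma> \<inter> D p = {} then 0 else w p)" for p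
  proof -
    have "(\<integral>\<^sup>+ x. w p / emeasure M (D p) * indicator (D p) x * indicator \<Gamma> x \<partial>M)
        = (\<integral>\<^sup>+ x. w p / emeasure M (D p) * indicator (\<Gamma> \<inter> D p) x \<partial>M)"
      by (intro nn_integral_cong) (simp add: indicator_inter_arith mult_ac)
    also have "\<dots> = w p / emeasure M (D p) * emeasure M (\<Gamma> \<inter> D p)"
      using \<Gamma> D(1) by (intro nn_integral_cmult_indicator) auto
    also have "\<dots> \<le> (if \<Gamma> \<inter> D p = {} then 0 else w p)"
      using ennreal_divide_mult_le[OF emeasure_mono[of "\<Gamma> \<inter> D p" "D p" M] radon_measure_bounded[OF assms(2) D(2)]] D(1)
      by auto
    finally show ?thesis .
  qed
  have "(\<integral>\<^sup>+ x. J_star2 M x * indicator \<Gamma> x \<partial>M)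
      = (\<integral>\<^sup>+ x. (\<Sum>n. w (e n) / emeasure M (D (e n)) * indicator (D (e n)) x * indicator \<Gamma> x) \<partial>M)"
    by (simp add: J ennreal_suminf_multc)
  also have "\<dots> = (\<Sum>n. \<integral>\<^sup>+ x. w (e n) / emeasure M (D (e n)) * indicator (D (e n)) x * indicator \<Gamma> x \<partial>M)"
    by (intro nn_integral_suminf borel_measurable_times_ennreal borel_measurable_const
          borel_measurable_indicator D(1) \<Gamma>)
  also have "\<dots> \<le> ennreal C"
  proof (rule suminf_le_const)
    fix N
    have "(\<Sum>n<N. \<integral>\<^sup>+ x. w (e n) / emeasure M (D (e n)) * indicator (D (e n)) x * indicator \<Gamma> x \<partial>M)
        \<le> (\<Sum>n<N. if \<Gamma> \<inter> D (e n) = {} then 0 else w (e n))"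
      by (intro sum_mono le_w)
    also have "\<dots> = (\<Sum>p\<in>e ` {..<N}. if \<Gamma> \<inter> D p = {} then 0 else w p)"
      by (subst sum.reindex) (auto intro: inj_on_subset[OF bij_betw_imp_inj_on[OF e]])
    also have "\<dots> = (\<Sum>p\<in>{p \<in> e ` {..<N}. \<Gamma> \<inter> D p \<noteq> {}}. w p)"
      by (subst sum.inter_filter) (auto intro: sum.cong)
    also have "\<dots> \<le> ennreal C"
    proof (rule C)
      have "e ` {..<N} \<subseteq> K" using bij_betw_imp_surj_on[OF e] by blast
      then show "\<forall>p\<in>{p \<in> e ` {..<N}. \<Gamma> \<inter> D p \<noteq> {}}. 0 \<le> fst p \<and> \<Gamma> \<inter> D p \<noteq> {}"
        by (auto simp: K_def)
    qed simp
    finally show "(\<Sum>n<N. \<integral>\<^sup>+ x. w (e n) / emeasure M (D (e n)) * indicator (D (e n)) x * indicator \<Gamma> x \<partial>M) \<le> ennreal C" .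
  qed simp
  finally have fin: "(\<integral>\<^sup>+ x. J_star2 M x * indicator \<Gamma> x \<partial>M) < \<infinity>"
    using ennreal_less_top[of C] by (simp add: order_le_less_trans)
  have "AE x in M. J_star2 M x * indicator \<Gamma> x \<noteq> \<infinity>"
    using meas \<Gamma> fin by (intro nn_integral_PInf_AE) auto
  then have "AE x in M. x \<in> \<Gamma> \<longrightarrow> J_star2 M x < \<infinity>"
    by (rule AE_mp) (auto simp: less_top)
  then show ?thesis using meas fin by blast
qed

end
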